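(* For any integer $q\geq 3$, the graph $H(q)$ is cubical, has no partite representation, but has a zero Turán density in a hypercube, i.e. $\mathrm{ex}(Q_n,H(q))=o(\|Q_n\|)$ as $n\to\infty$.
   Context: Graphs are finite and simple. $\|G\|$ denotes the number of edges of a graph $G$. The hypercube $Q_n$ (with ground set $[n]=\{1,\dots,n\}$) is the graph with vertex set $\{A: A\subseteq [n]\}$ whose edges are all pairs $\{A,B\}$ with $A\subseteq B$ and $|A|=|B|-1$. A graph is cubical if it is (isomorphic to) a subgraph of $Q_n$ for some $n$. The $i$th vertex layer of $Q_n$ is $V_i=\binom{[n]}{i}$, $0\le i\le n$. The $i$th edge-layer (or simply $i$th layer) $L_i$ of $Q_n$ is the subgraph of $Q_n$ induced by $V_i\cup V_{i-1}$, $1\le i\le n$. For a graph $H$, $\mathrm{ex}(Q_n,H)$ is the largest number of edges in a subgraph $G$ of $Q_n$ such that no subgraph of $G$ is isomorphic to $H$. $H$ has zero Turán density in a hypercube if $\mathrm{ex}(Q_n,H)=o(\|Q_n\|)$. A $k$-uniform hypergraph is $k$-partite if its vertex set can be partitioned into $k$ parts such that each hyperedge has exactly one vertex in each part. A graph $H$ has a $k$-partite representation if for some $n$, $H$ is isomorphic to a subgraph $H'$ (not necessarily induced) of the $k$th layer $L_k$ of $Q_n$ such that $V(H')\cap V_k$ is the edge set of a $k$-partite $k$-uniform hypergraph. $H$ has a partite representation if it has a $k$-partite representation for some $k$. For a graph $G$, its $1$-subdivision $G(1)$ is the graph with vertex set $V(G)\cup E(G)$ and edge set $\{ue, ev : e=uv\in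 E(G)\}$; the vertices from $V(G)$ are called poles and the vertices from $E(G)$ are called subdivision vertices. $K_{s,t}$ is the complete bipartite graph with parts of sizes $s$ and $t$. For $q\ge 3$, $\Theta(q)=K_{q,2}(1)$ is the $1$-subdivision of $K_{q,2}$, and its main poles are its two vertices of degree $q$. The graph $H(q)$ is the union of two copies of $\Theta(q)$ sharing exactly one vertex, which is a main pole of one copy and a subdivision vertex of the other copy. *)

theory Defs
  imports Complex_Main "HOL-Library.Disjoint_Sets" "HOL-Library.Landau_Symbols"
begin

section \<open>Finite simple graphs\<close>

datatype 'a graph = Graph (verts: "'a set") (edges: "'a set set")

definition simple_graph :: "'a graph \<Rightarrow> bool" where
  "simple_graph G \<longleftrightarrow> finite (verts G) \<and> (\<forall>e\<in>edges G. e \<subseteq> verts G \<and> card e = 2)"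

definition subgraph :: "'a graph \<Rightarrow> 'a graph \<Rightarrow> bool" where
  "subgraph H G \<longleftrightarrow> simple_graph H \<and> verts H \<subseteq> verts G \<and> edges H \<subseteq> edges G"

definition induced_subgraph :: "'a graph \<Rightarrow> 'a set \<Rightarrow> 'a graph" where
  "induced_subgraph G U = Graph (verts G \<inter> U) {e \<in> edges G. e \<subseteq> U}"

definition isomorphic :: "'a graph \<Rightarrow> 'b graph \<Rightarrow> bool" where
  "isomorphic G H \<longleftrightarrow> (\<exists>f. bij_betw f (verts G) (verts H) \<and>
     (\<forall>u\<in>verts G. \<forall>v\<in>verts G. {u, v} \<in> edges G \<longleftrightarrow> {f u, f v} \<in> edges H))"

definition degree :: "'a graph \<Rightarrow> 'a \<Rightarrow> nat" where
  "degree G v = card {e \<in> edges G. v \<in> e}"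

definition graph_union :: "'a graph \<Rightarrow> 'a graph \<Rightarrow> 'a graph" where
  "graph_union G H = Graph (verts G \<union> verts H) (edges G \<union> edges H)"

definition graph_image :: "('a \<Rightarrow> 'b) \<Rightarrow> 'a graph \<Rightarrow> 'b graph" where
  "graph_image f G = Graph (f ` verts G) ((`) f ` edges G)"

text \<open>For \<open>H\<close> with at least one vertex the maximum below is over a nonempty finite set
  whenever \<open>G\<close> is finite; see \<open>ex_number_wf\<close>.\<close>

definition ex_number :: "'a graph \<Rightarrow> 'b graph \<Rightarrow> nat" where
  "ex_number G H = Max {card (edges G') | G'. subgraph G' G \<and>
     \<not> (\<exists>H'. subgraph H' G' \<and> isomorphic H H')}"


section \<open>The hypercube\<close>

definition hypercube :: "nat \<Rightarrow> nat set graph" where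
  "hypercube n = Graph (Pow {1..n})
     {{A, B} | A B. A \<subseteq> B \<and> B \<subseteq> {1..n} \<and> card B = card A + 1}"

definition vertex_layer :: "nat \<Rightarrow> nat \<Rightarrow> nat set set" where
  "vertex_layer n i = {A. A \<subseteq> {1..n} \<and> card A = i}"

text \<open>Only used for \<open>1 \<le> i \<le> n\<close>.\<close>

definition edge_layer :: "nat \<Rightarrow> nat \<Rightarrow> nat set graph" where
  "edge_layer n i = induced_subgraph (hypercube n) (vertex_layer n i \<union> vertex_layer n (i - 1))"

definition cubical :: "'a graph \<Rightarrow> bool" where
  "cubical H \<longleftrightarrow> (\<exists>n H'. subgraph H' (hypercube n) \<and> isomorphic H H')"

definition zero_turan_density :: "'a graph \<Rightarrow> bool" where
  "zero_turan_density H \<longleftrightarrow>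
     (\<lambda>n. real (ex_number (hypercube n) H)) \<in> o(\<lambda>n. real (card (edges (hypercube n))))"


section \<open>Partite representations\<close>

definition uniform_hypergraph :: "nat \<Rightarrow> 'a set \<Rightarrow> 'a set set \<Rightarrow> bool" where
  "uniform_hypergraph k X F \<longleftrightarrow> finite X \<and> (\<forall>e\<in>F. e \<subseteq> X \<and> card e = k)"

definition partite_hypergraph :: "nat \<Rightarrow> 'a set \<Rightarrow> 'a set set \<Rightarrow> bool" where
  "partite_hypergraph k X F \<longleftrightarrow> uniform_hypergraph k X F \<and>
     (\<exists>P. partition_on X P \<and> card P = k \<and> (\<forall>e\<in>F. \<forall>p\<in>P. card (e \<inter> p) = 1))"

definition has_k_partite_representation :: "nat \<Rightarrow> 'a graph \<Rightarrow> bool" where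
  "has_k_partite_representation k H \<longleftrightarrow> (\<exists>n H'. 1 \<le> k \<and> k \<le> n \<and>
     subgraph H' (edge_layer n k) \<and> isomorphic H H' \<and>
     (\<exists>X. partite_hypergraph k X (verts H' \<inter> vertex_layer n k)))"

definition has_partite_representation :: "'a graph \<Rightarrow> bool" where
  "has_partite_representation H \<longleftrightarrow> (\<exists>k. has_k_partite_representation k H)"


section \<open>The graphs \<open>\<Theta>(q)\<close> and \<open>H(q)\<close>\<close>

definition complete_bipartite :: "nat \<Rightarrow> nat \<Rightarrow> (nat + nat) graph" where
  "complete_bipartite s t = Graph (Inl ` {..<s} \<union> Inr ` {..<t})
     {{Inl i, Inr j} | i j. i < s \<and> j < t}"

text \<open>A pole \<open>v\<close> is represented by \<open>Inl v\<close>, the subdivision vertex of an edge \<open>e\<close> by \<open>Inr e\<close>.\<close>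

definition subdivision1 :: "'a graph \<Rightarrow> ('a + 'a set) graph" where
  "subdivision1 G = Graph (Inl ` verts G \<union> Inr ` edges G)
     {{Inl u, Inr e} | u e. e \<in> edges G \<and> u \<in> e}"

type_synonym theta_vertex = "(nat + nat) + (nat + nat) set"

definition Theta :: "nat \<Rightarrow> theta_vertex graph" where
  "Theta q = subdivision1 (complete_bipartite q 2)"

definition main_poles :: "nat \<Rightarrow> theta_vertex set" where
  "main_poles q = {v \<in> verts (Theta q). degree (Theta q) v = q}"

definition subdivision_vertices :: "nat \<Rightarrow> theta_vertex set" where
  "subdivision_vertices q = Inr ` edges (complete_bipartite q 2)"

text \<open>The second copy of \<open>\<Theta>(q)\<close> is glued to the first by identifying its main pole
  \<open>glue_pole\<close> with the subdivision vertex \<open>glue_subdiv\<close> of the first copy. Up to isomorphism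
  the choice of the two vertices is immaterial, since the automorphisms of \<open>\<Theta>(q)\<close> act
  transitively on its main poles and on its subdivision vertices.\<close>

definition glue_pole :: theta_vertex where
  "glue_pole = Inl (Inr 0)"

definition glue_subdiv :: theta_vertex where
  "glue_subdiv = Inr {Inl 0, Inr 0}"

definition second_copy :: "theta_vertex \<Rightarrow> theta_vertex + theta_vertex" where
  "second_copy v = (if v = glue_pole then Inl glue_subdiv else Inr v)"

definition H_graph :: "nat \<Rightarrow> (theta_vertex + theta_vertex) graph" where
  "H_graph q = graph_union (graph_image Inl (Theta q)) (graph_image second_copy (Theta q))"


section \<open>Consistency of the definitions\<close>

lemma simple_graph_hypercube: "simple_graph (hypercube n)"
proof -
  have "card {A, B} = 2" if "card B = card A + 1" for A B :: "nat set"
    using that by (cases "A = B") auto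
  then show ?thesis by (auto simp: simple_graph_def hypercube_def)
qed

lemma simple_graph_induced: "simple_graph G \<Longrightarrow> simple_graph (induced_subgraph G U)"
  by (auto simp: simple_graph_def induced_subgraph_def)

lemma simple_graph_edge_layer: "simple_graph (edge_layer n k)"
  by (simp add: edge_layer_def simple_graph_induced simple_graph_hypercube)

lemma simple_graph_complete_bipartite: "simple_graph (complete_bipartite s t)"
  by (auto simp: simple_graph_def complete_bipartite_def)

lemma simple_graph_finite_edges: "simple_graph G \<Longrightarrow> finite (edges G)"
  unfolding simple_graph_def by (metis Pow_iff finite_Pow_iff finite_subset subsetI)

lemma simple_graph_subdivision1: "simple_graph G \<Longrightarrow> simple_graph (subdivision1 G)"
  using simple_graph_finite_edges[of G]
  by (auto simp: simple_graph_def subdivision1_def)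

lemma simple_graph_Theta: "simple_graph (Theta q)"
  by (simp add: Theta_def simple_graph_subdivision1 simple_graph_complete_bipartite)

lemma inj_second_copy: "inj second_copy"
  by (auto simp: inj_def second_copy_def)

lemma simple_graph_graph_image:
  assumes "simple_graph G" "inj f"
  shows "simple_graph (graph_image f G)"
  using assms card_image[OF inj_on_subset[OF assms(2) subset_UNIV]]
  by (auto simp: simple_graph_def graph_image_def)

lemma simple_graph_H_graph: "simple_graph (H_graph q)"
  using simple_graph_graph_image[OF simple_graph_Theta inj_second_copy, of q]
    simple_graph_graph_image[OF simple_graph_Theta inj_Inl, of q]
  by (auto simp: H_graph_def graph_union_def simple_graph_def)

lemma isomorphic_graph_image:
  assumes "inj f"
  shows "isomorphic G (graph_image f G)"
  unfolding isomorphic_def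
proof (intro exI conjI ballI)
  show "bij_betw f (verts G) (verts (graph_image f G))"
    using assms by (auto simp: graph_image_def bij_betw_def intro: inj_on_subset)
  show "{u, v} \<in> edges G \<longleftrightarrow> {f u, f v} \<in> edges (graph_image f G)" for u v
  proof -
    have "inj ((`) f)"
      using inj_image_eq_iff[OF assms] by (auto simp: inj_def)
    from inj_image_mem_iff[OF this, of "{u, v}"] show ?thesis
      by (simp add: graph_image_def)
  qed
qed

lemma main_poles_eq:
  assumes "q \<ge> 3"
  shows "main_poles q = {Inl (Inr 0), Inl (Inr 1)}"
proof -
  have E: "edges (Theta q) = {{Inl u, Inr {Inl i, Inr j}} | u i j.
      i < q \<and> j < 2 \<and> (u = Inl i \<or> u = Inr j)}"
    unfolding Theta_def subdivision1_def complete_bipartite_def graph.sel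
    by (rule Collect_cong) blast
  have dr: "degree (Theta q) (Inl (Inr j)) = q" if "j < 2" for j
  proof -
    have "{e \<in> edges (Theta q). Inl (Inr j) \<in> e} =
        (\<lambda>i. {Inl (Inr j), Inr {Inl i, Inr j}}) ` {..<q}"
      using that unfolding E by (auto simp: doubleton_eq_iff)
    moreover have "inj_on (\<lambda>i. {Inl (Inr j), Inr {Inl i, Inr j}} :: theta_vertex set) {..<q}"
      by (auto simp: inj_on_def doubleton_eq_iff)
    ultimately show ?thesis by (simp add: degree_def card_image)
  qed
  have dl: "degree (Theta q) (Inl (Inl i)) \<le> 2" if "i < q" for i
  proof -
    have "{e \<in> edges (Theta q). Inl (Inl i) \<in> e} \<subseteq>
        (\<lambda>j. {Inl (Inl i), Inr {Inl i, Inr j}}) ` {..<2}"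
      using that unfolding E by auto
    from surj_card_le[OF _ this] show ?thesis by (simp add: degree_def)
  qed
  have ds: "degree (Theta q) (Inr {Inl i, Inr j}) \<le> 2" if "i < q" "j < 2" for i j
  proof -
    have "{e \<in> edges (Theta q). Inr {Inl i, Inr j} \<in> e} \<subseteq>
        (\<lambda>v. {Inl v, Inr {Inl i, Inr j}}) ` {Inl i, Inr j}"
      using that unfolding E by auto
    from surj_card_le[OF _ this] show ?thesis by (simp add: degree_def)
  qed
  show ?thesis
  proof (intro equalityI subsetI)
    fix v assume "v \<in> main_poles q"
    then have v: "v \<in> verts (Theta q)" "degree (Theta q) v = q"
      by (simp_all add: main_poles_def)
    from v(1) consider (l) i where "v = Inl (Inl i)" "i < q"
      | (r) j where "v = Inl (Inr j)" "j < 2"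
      | (s) i j where "v = Inr {Inl i, Inr j}" "i < q" "j < 2"
      by (auto simp: Theta_def subdivision1_def complete_bipartite_def)
    then show "v \<in> {Inl (Inr 0), Inl (Inr 1)}"
    proof cases
      case l then show ?thesis using dl[of i] v(2) assms by simp
    next
      case r then show ?thesis by (auto simp: less_2_cases_iff)
    next
      case s then show ?thesis using ds[of i j] v(2) assms by simp
    qed
  next
    fix v assume "v \<in> {Inl (Inr 0), Inl (Inr 1) :: theta_vertex}"
    then obtain j :: nat where "v = Inl (Inr j)" "j < 2" by auto
    then show "v \<in> main_poles q"
      using dr[of j] by (simp add: main_poles_def Theta_def subdivision1_def complete_bipartite_def)
  qed
qed

lemma glue_pole_main: "q \<ge> 3 \<Longrightarrow> glue_pole \<in> main_poles q"
  by (simp add: main_poles_eq glue_pole_def)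

lemma glue_subdiv_subdivision: "q \<ge> 3 \<Longrightarrow> glue_subdiv \<in> subdivision_vertices q"
  unfolding glue_subdiv_def subdivision_vertices_def complete_bipartite_def graph.sel
  by (intro imageI CollectI exI[of _ 0]) simp

lemma copies_share_one_vertex:
  assumes "q \<ge> 3"
  shows "verts (graph_image Inl (Theta q)) \<inter> verts (graph_image second_copy (Theta q))
    = {Inl glue_subdiv}"
proof -
  have "glue_pole \<in> verts (Theta q)"
    using glue_pole_main[OF assms] by (simp add: main_poles_def)
  moreover have "glue_subdiv \<in> verts (Theta q)"
    using glue_subdiv_subdivision[OF assms]
    by (simp add: subdivision_vertices_def Theta_def subdivision1_def)
  moreover have "second_copy glue_pole = Inl glue_subdiv"
    by (simp add: second_copy_def)
  moreover have "x = Inl glue_subdiv"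
    if "x = Inl u" "x = second_copy v" for x u v
    using that unfolding second_copy_def by (cases "v = glue_pole") simp_all
  ultimately show ?thesis
    unfolding graph_image_def graph.sel
    by (intro equalityI subsetI) (elim IntE imageE, simp, metis IntI imageI singletonD)
qed

lemma ex_number_wf:
  assumes "simple_graph G" "verts H \<noteq> {}"
  defines "S \<equiv> {card (edges G') | G'. subgraph G' G \<and> \<not> (\<exists>H'. subgraph H' G' \<and> isomorphic H H')}"
  shows "finite S" "S \<noteq> {}"
proof -
  have "S \<subseteq> {..card (edges G)}"
  proof
    fix m assume "m \<in> S"
    then obtain G' where "subgraph G' G" "m = card (edges G')"
      unfolding S_def by blast
    then show "m \<in> {..card (edges G)}"
      using card_mono[OF simple_graph_finite_edges[OF assms(1)]] by (simp add: subgraph_def)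
  qed
  then show "finite S" by (rule finite_subset) simp
  define G0 where "G0 = (Graph {} {} :: 'a graph)"
  have 1: "subgraph G0 G" by (simp add: G0_def subgraph_def simple_graph_def)
  have 2: "\<not> (\<exists>H'. subgraph H' G0 \<and> isomorphic H H')"
  proof
    assume "\<exists>H'. subgraph H' G0 \<and> isomorphic H H'"
    then obtain H' where H': "subgraph H' G0" "isomorphic H H'" by blast
    from H'(2) obtain f where "bij_betw f (verts H) (verts H')"
      unfolding isomorphic_def by blast
    moreover have "verts H' = {}"
      using H'(1) by (simp add: G0_def subgraph_def)
    ultimately show False using assms(2) by (simp add: bij_betw_def)
  qed
  have "card (edges G0) \<in> S"
    unfolding S_def by (intro CollectI exI[of _ G0] conjI refl 1 2)
  then show "S \<noteq> {}" by fast
qed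

end

theory Submission
  imports Defs "HOL-Combinatorics.Transposition" "HOL-Real_Asymp.Real_Asymp"
begin

text \<open>For \<open>q \<ge> 3\<close>, a copy of \<open>\<Theta>(q)\<close> inside one layer of the cube comes in two complementary shapes. Either its poles are the sets
\<open>S \<union> {a}\<close> and its subdivision vertices the sets \<open>S \<union> {a, b}\<close>, where \<open>ab\<close> runs through the edges of a \<open>K\<^bsub>q,2\<^esub>\<close>, or all
these sets are removed from \<open>S\<close> instead of added. In the second shape the poles lie in the upper
layer and three of them are facets of one set of size \<open>k + 1\<close>; a \<open>k\<close>-partite hypergraph contains no such triple
(\<open>partite_no_three_facets\<close>). So in a partite representation every copy of \<open>\<Theta>(q)\<close> has its main poles below
(\<open>main_pole_not_top\<close>), which is impossible for both copies in \<open>H(q)\<close> at once, because their common vertex is a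
subdivision vertex of one and a main pole of the other.

Without partiteness both shapes are available, and they can be glued. For a dense subgraph of a layer consider the link graphs
\<open>up_link\<close> and \<open>down_link\<close>, in which a \<open>K\<^bsub>2,q\<^esub>\<close> is a \<open>\<Theta>(q)\<close> of the first or of the second
shape. In any graph all but a small proportion of the pairs are either non-adjacent or lie in a \<open>K\<^bsub>2,r\<^esub>\<close>, with a prescribed end of the edge on the
side of size two (\<open>few_poor_edges\<close>). Double counting transfers this to the vertices of the upper layer: a positive
proportion of them has many down-neighbours that themselves have many up-neighbours (\<open>many_popular_vertices\<close>), few of these
fail to be a subdivision vertex of the first shape (\<open>few_vertices_without_up_rich\<close>), and few fail to be a
main pole of the second shape in many ways (\<open>few_vertices_without_down_rich\<close>). A vertex that is
both gives \<open>H(q)\<close> (\<open>rich_vertex_gives_H_graph\<close>).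

This bounds the density of an \<open>H(q)\<close>-free graph in every layer that is not close to the bottom or the top, and the
other layers are negligible. Finally, zero density forces some cube to contain \<open>H(q)\<close>, which is
cubicality (\<open>zero_turan_density_imp_cubical\<close>).\<close>


section \<open>Placing copies of \<open>\<Theta>(q)\<close> and \<open>H(q)\<close>\<close>

lemma Theta_edges:
  "edges (Theta q) = {{Inl a, Inr e} | a e. e \<in> edges (complete_bipartite q 2) \<and> a \<in> e}"
  by (auto simp: Theta_def subdivision1_def)

lemma Theta_verts:
  "verts (Theta q) = Inl ` verts (complete_bipartite q 2) \<union> Inr ` edges (complete_bipartite q 2)"
  by (simp add: Theta_def subdivision1_def)

lemma Theta_edge:
  assumes "i < q" "j < 2"
  shows "{Inl (Inl i), Inr {Inl i, Inr j}} \<in> edges (Theta q)"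
    and "{Inl (Inr j), Inr {Inl i, Inr j}} \<in> edges (Theta q)"
  using assms by (auto simp: Theta_edges complete_bipartite_def)

lemma Theta_vert:
  assumes "i < q" "j < 2"
  shows "Inl (Inl i) \<in> verts (Theta q)" "Inl (Inr j) \<in> verts (Theta q)"
    "Inr {Inl i, Inr j} \<in> verts (Theta q)"
  using assms by (auto simp: Theta_verts complete_bipartite_def)

lemma Theta_edge_cases:
  assumes "e \<in> edges (Theta q)"
  obtains (middle) i j where "i < q" "j < 2" "e = {Inl (Inl i), Inr {Inl i, Inr j}}"
    | (main) i j where "i < q" "j < 2" "e = {Inl (Inr j), Inr {Inl i, Inr j}}"
proof -
  obtain a d i j where "i < q" "j < 2" "e = {Inl a, Inr d}" "d = {Inl i, Inr j}" "a \<in> d"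
    using assms unfolding Theta_edges complete_bipartite_def graph.sel by blast
  then show ?thesis using middle[of i j] main[of i j] by blast
qed

lemma Theta_vertex_in_edge:
  assumes "0 < q" "v \<in> verts (Theta q)"
  shows "\<exists>e\<in>edges (Theta q). v \<in> e"
proof -
  consider i where "v = Inl (Inl i)" "i < q" | j where "v = Inl (Inr j)" "j < 2"
    | i j where "v = Inr {Inl i, Inr j}" "i < q" "j < 2"
    using assms(2) by (auto simp: Theta_verts complete_bipartite_def)
  then show ?thesis
  proof cases
    case (1 i) then show ?thesis by (intro bexI[OF _ Theta_edge(1)[of i q 0]]) simp_all
  next
    case (2 j) then show ?thesis using assms(1) by (intro bexI[OF _ Theta_edge(2)[of 0 q j]]) simp_all
  next
    case (3 i j) then show ?thesis by (intro bexI[OF _ Theta_edge(1)[of i q j]]) simp_all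
  qed
qed

lemma isomorphic_image_subgraph:
  assumes "simple_graph H" "simple_graph G" "inj_on f (verts H)" "f ` verts H \<subseteq> verts G"
    and "\<And>e. e \<in> edges H \<Longrightarrow> f ` e \<in> edges G"
  shows "\<exists>H'. subgraph H' G \<and> isomorphic H H'"
proof (intro exI conjI)
  have sub: "e \<subseteq> verts H" "card e = 2" if "e \<in> edges H" for e
    using assms(1) that by (auto simp: simple_graph_def)
  have card2: "card (f ` e) = 2" if "e \<in> edges H" for e
    using sub[OF that] card_image[OF inj_on_subset[OF assms(3)]] by metis
  have "f ` e \<subseteq> f ` verts H" if "e \<in> edges H" for e
    using sub(1)[OF that] by (rule image_mono)
  moreover have "finite (f ` verts H)" using assms(1) by (simp add: simple_graph_def)
  ultimately show "subgraph (graph_image f H) G"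
    using card2 assms(4,5) unfolding subgraph_def graph_image_def simple_graph_def graph.sel by blast
  show "isomorphic H (graph_image f H)"
    unfolding isomorphic_def
  proof (intro exI conjI ballI)
    show "bij_betw f (verts H) (verts (graph_image f H))"
      using assms(3) by (simp add: graph_image_def bij_betw_def)
    fix u v assume uv: "u \<in> verts H" "v \<in> verts H"
    have "e = {u, v}" if "e \<in> edges H" "f ` e = f ` {u, v}" for e
      using inj_on_image_eq_iff[OF assms(3), of e "{u, v}"] sub[OF that(1)] that uv by simp
    then have "f ` {u, v} \<in> (`) f ` edges H \<longleftrightarrow> {u, v} \<in> edges H"
      by blast
    then show "{u, v} \<in> edges H \<longleftrightarrow> {f u, f v} \<in> edges (graph_image f H)"
      by (simp add: graph_image_def)
  qed
qed

text \<open>To find \<open>H(q)\<close> it suffices to place the two copies of \<open>\<Theta>(q)\<close> separately. The map \<open>second_copy\<close> sends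
\<open>glue_pole\<close> to the vertex \<open>Inl glue_subdiv\<close> of the first copy, so \<open>case_sum g1 g2\<close> composed with it is \<open>g2\<close>
exactly when the two placements agree there.\<close>
lemma H_graph_embedding:
  assumes "simple_graph G" "0 < q"
    and inj: "inj_on g1 (verts (Theta q))" "inj_on g2 (verts (Theta q))"
    and glue: "g1 glue_subdiv = g2 glue_pole"
    and disj: "g1 ` verts (Theta q) \<inter> g2 ` (verts (Theta q) - {glue_pole}) = {}"
    and edges: "\<And>e. e \<in> edges (Theta q) \<Longrightarrow> g1 ` e \<in> edges G"
      "\<And>e. e \<in> edges (Theta q) \<Longrightarrow> g2 ` e \<in> edges G"
  shows "\<exists>H'. subgraph H' G \<and> isomorphic (H_graph q) H'"
proof (rule isomorphic_image_subgraph[OF simple_graph_H_graph assms(1)])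
  let ?h = "case_sum g1 g2" and ?V = "verts (Theta q)"
  have h2: "?h (second_copy v) = g2 v" for v
    using glue by (simp add: second_copy_def)
  have V: "verts (H_graph q) = Inl ` ?V \<union> second_copy ` ?V"
    by (simp add: H_graph_def graph_union_def graph_image_def)
  have E: "edges (H_graph q) = (`) Inl ` edges (Theta q) \<union> (`) second_copy ` edges (Theta q)"
    by (simp add: H_graph_def graph_union_def graph_image_def)
  have cross: "Inl u = second_copy v" if "u \<in> ?V" "v \<in> ?V" "g1 u = g2 v" "glue_subdiv \<in> ?V" for u v
  proof (cases "v = glue_pole")
    case True
    then have "u = glue_subdiv" using that inj(1) glue by (metis inj_onD)
    then show ?thesis using True by (simp add: second_copy_def)
  next
    case False then show ?thesis using disj that by blast
  qed
  have gs: "glue_subdiv \<in> ?V"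
    using Theta_vert(3)[of 0 q 0] \<open>0 < q\<close> by (simp add: glue_subdiv_def)
  show "inj_on ?h (verts (H_graph q))"
  proof (rule inj_onI)
    fix x y assume xy: "x \<in> verts (H_graph q)" "y \<in> verts (H_graph q)" "?h x = ?h y"
    consider u v where "x = Inl u" "y = Inl v" "u \<in> ?V" "v \<in> ?V"
      | u v where "x = Inl u" "y = second_copy v" "u \<in> ?V" "v \<in> ?V"
      | u v where "x = second_copy u" "y = Inl v" "u \<in> ?V" "v \<in> ?V"
      | u v where "x = second_copy u" "y = second_copy v" "u \<in> ?V" "v \<in> ?V"
      using xy(1,2) unfolding V by blast
    then show "x = y"
    proof cases
      case 1 then show ?thesis using xy(3) inj(1) by (auto dest: inj_onD)
    next
      case 2 then show ?thesis using xy(3) cross[of u v] h2 gs by simp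
    next
      case 3 then show ?thesis using xy(3) cross[of v u] h2 gs by simp
    next
      case 4 then show ?thesis using xy(3) inj(2) h2 by (auto dest: inj_onD)
    qed
  qed
  have verts: "g ` ?V \<subseteq> verts G" if "\<And>e. e \<in> edges (Theta q) \<Longrightarrow> g ` e \<in> edges G" for g
  proof
    fix y assume "y \<in> g ` ?V"
    then obtain v where v: "v \<in> ?V" "y = g v" by blast
    obtain e where e: "e \<in> edges (Theta q)" "v \<in> e" using Theta_vertex_in_edge[OF \<open>0 < q\<close> v(1)] by blast
    then have "y \<in> g ` e" using v(2) by blast
    then show "y \<in> verts G" using that[OF e(1)] \<open>simple_graph G\<close> unfolding simple_graph_def by blast
  qed
  show "?h ` verts (H_graph q) \<subseteq> verts G"
    using verts[OF edges(1)] verts[OF edges(2)] unfolding V image_Un image_image h2 by simp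
  show "?h ` e \<in> edges G" if "e \<in> edges (H_graph q)" for e
    using that edges unfolding E by (elim UnE imageE) (simp_all add: image_image h2)
qed

text \<open>A labelling \<open>\<phi>\<close> of the vertices of \<open>K\<^bsub>q,2\<^esub>\<close> by elements of the ground set turns every vertex of \<open>\<Theta>(q)\<close> into a
set of one or two elements: a pole gives a singleton, a subdivision vertex the pair of labels of its edge.
Adding these sets to a fixed set, or removing them from one, places \<open>\<Theta>(q)\<close> in a layer of the cube.\<close>
definition support :: "(nat + nat \<Rightarrow> 'b) \<Rightarrow> theta_vertex \<Rightarrow> 'b set" where
  "support \<phi> = case_sum (\<lambda>a. {\<phi> a}) (\<lambda>e. \<phi> ` e)"

text \<open>Poles and subdivision vertices cannot be confused because their supports have different sizes.\<close>
lemma inj_on_support: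
  assumes "inj_on \<phi> (verts (complete_bipartite q 2))"
  shows "inj_on (support \<phi>) (verts (Theta q))"
proof (rule inj_onI)
  let ?K = "complete_bipartite q 2"
  have e: "e \<subseteq> verts ?K" "card (\<phi> ` e) = 2" if "e \<in> edges ?K" for e
  proof -
    show s: "e \<subseteq> verts ?K" using simple_graph_complete_bipartite that
      unfolding simple_graph_def by blast
    have "card e = 2" using simple_graph_complete_bipartite that unfolding simple_graph_def by blast
    then show "card (\<phi> ` e) = 2" using card_image[OF inj_on_subset[OF assms s]] by simp
  qed
  have ne: "{\<phi> a} \<noteq> \<phi> ` e" if "e \<in> edges ?K" for a e
  proof
    assume "{\<phi> a} = \<phi> ` e"
    then have "card (\<phi> ` e) = 1" by (metis is_singletonI is_singleton_altdef)
    then show False using e(2)[OF that] by simp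
  qed
  fix x y assume "x \<in> verts (Theta q)" "y \<in> verts (Theta q)" "support \<phi> x = support \<phi> y"
  then show "x = y"
    unfolding Theta_verts support_def
    using ne ne[symmetric] inj_onD[OF assms] inj_on_image_eq_iff[OF assms e(1) e(1)]
    by (elim UnE imageE) auto
qed

lemma support_subset:
  "v \<in> verts (Theta q) \<Longrightarrow> support \<phi> v \<subseteq> \<phi> ` verts (complete_bipartite q 2)"
  by (auto simp: Theta_verts support_def complete_bipartite_def)

definition labelling :: "(nat \<Rightarrow> 'b) \<Rightarrow> 'b \<Rightarrow> 'b \<Rightarrow> nat + nat \<Rightarrow> 'b" where
  "labelling x u t = case_sum x (\<lambda>j. if j = 0 then u else t)"

lemma labelling_image: "labelling x u t ` verts (complete_bipartite q 2) \<subseteq> {u, t} \<union> x ` {..<q}"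
  by (auto simp: labelling_def complete_bipartite_def)

lemma inj_on_labelling:
  assumes "inj_on x {..<q}" "u \<noteq> t" "{u, t} \<inter> x ` {..<q} = {}"
  shows "inj_on (labelling x u t) (verts (complete_bipartite q 2))"
proof -
  have *: "x i \<noteq> u" "x i \<noteq> t" "u \<noteq> x i" "t \<noteq> x i" if "i < q" for i
    using that assms(3) by auto
  show ?thesis
    using assms(1,2)
    by (auto simp: labelling_def complete_bipartite_def inj_on_def * less_2_cases_iff split: if_splits)
qed

text \<open>The placement \<open>v \<mapsto> S \<union> support v\<close> puts the poles of \<open>\<Theta>(q)\<close> in the lower vertex layer and the subdivision
vertices in the upper one. The last conclusion bounds the elements that the copy involves.\<close>
lemma Theta_in_up_link:
  assumes x: "inj_on x {..<q}" "u \<noteq> t" "{u, t} \<inter> x ` {..<q} = {}"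
    and out: "S \<inter> ({u, t} \<union> x ` {..<q}) = {}"
    and adj: "\<And>i p. i < q \<Longrightarrow> p \<in> {u, t} \<Longrightarrow>
      {S \<union> {p}, S \<union> {p, x i}} \<in> E \<and> {S \<union> {x i}, S \<union> {p, x i}} \<in> E"
  defines "g \<equiv> \<lambda>v. S \<union> support (labelling x u t) v"
  shows "inj_on g (verts (Theta q))" "\<And>e. e \<in> edges (Theta q) \<Longrightarrow> g ` e \<in> E"
    "\<And>v. v \<in> verts (Theta q) \<Longrightarrow> g v \<subseteq> S \<union> ({u, t} \<union> x ` {..<q})"
proof -
  let ?\<phi> = "labelling x u t"
  show "g v \<subseteq> S \<union> ({u, t} \<union> x ` {..<q})" if "v \<in> verts (Theta q)" for v
    using support_subset[OF that, of ?\<phi>] labelling_image[of x u t q] unfolding g_def by blast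
  have "S \<inter> support ?\<phi> v = {}" if "v \<in> verts (Theta q)" for v
    using support_subset[OF that, of ?\<phi>] labelling_image[of x u t q] out by blast
  then have "g v - S = support ?\<phi> v" if "v \<in> verts (Theta q)" for v
    using that unfolding g_def by blast
  then show "inj_on g (verts (Theta q))"
    using inj_on_support[OF inj_on_labelling[OF x]] by (metis (no_types, lifting) inj_on_def)
  show "g ` e \<in> E" if "e \<in> edges (Theta q)" for e
    using that
  proof (cases rule: Theta_edge_cases)
    case (middle i j)
    then have "g ` e = {S \<union> {x i}, S \<union> {if j = 0 then u else t, x i}}"
      by (simp add: g_def support_def labelling_def insert_commute)
    then show ?thesis using adj[of i] middle(1) by auto
  next
    case (main i j)
    then have "g ` e = {S \<union> {if j = 0 then u else t}, S \<union> {if j = 0 then u else t, x i}}"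
      by (simp add: g_def support_def labelling_def insert_commute)
    then show ?thesis using adj[of i] main(1) by auto
  qed
qed

text \<open>The placement \<open>v \<mapsto> S - support v\<close> is the complementary one, with the poles in the upper layer. By the last
conclusion every vertex other than the pole \<open>S - {u}\<close> either contains \<open>u\<close> or misses one of the \<open>x i\<close>; this is
what separates the copy from a copy that avoids \<open>u\<close> and all of whose vertices contain all the \<open>x i\<close>.\<close>
lemma Theta_in_down_link:
  assumes x: "inj_on x {..<q}" "u \<noteq> t" "{u, t} \<inter> x ` {..<q} = {}"
    and out: "{u, t} \<union> x ` {..<q} \<subseteq> S"
    and adj: "\<And>i p. i < q \<Longrightarrow> p \<in> {u, t} \<Longrightarrow>
      {S - {p}, S - {p, x i}} \<in> E \<and> {S - {x i}, S - {p, x i}} \<in> E"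
  defines "g \<equiv> \<lambda>v. S - support (labelling x u t) v"
  shows "inj_on g (verts (Theta q))" "\<And>e. e \<in> edges (Theta q) \<Longrightarrow> g ` e \<in> E"
    "\<And>v. v \<in> verts (Theta q) - {glue_pole} \<Longrightarrow> u \<in> g v \<or> (\<exists>i<q. x i \<notin> g v)"
proof -
  let ?\<phi> = "labelling x u t"
  have "support ?\<phi> v \<subseteq> S" if "v \<in> verts (Theta q)" for v
    using support_subset[OF that, of ?\<phi>] labelling_image[of x u t q] out by blast
  then have "S - g v = support ?\<phi> v" if "v \<in> verts (Theta q)" for v
    using that unfolding g_def by blast
  then show "inj_on g (verts (Theta q))"
    using inj_on_support[OF inj_on_labelling[OF x]] by (metis (no_types, lifting) inj_on_def)
  show "g ` e \<in> E" if "e \<in> edges (Theta q)" for e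
    using that
  proof (cases rule: Theta_edge_cases)
    case (middle i j)
    then have "g ` e = {S - {x i}, S - {if j = 0 then u else t, x i}}"
      by (simp add: g_def support_def labelling_def insert_commute)
    then show ?thesis using adj[of i] middle(1) by auto
  next
    case (main i j)
    then have "g ` e = {S - {if j = 0 then u else t}, S - {if j = 0 then u else t, x i}}"
      by (simp add: g_def support_def labelling_def insert_commute)
    then show ?thesis using adj[of i] main(1) by auto
  qed
  show "u \<in> g v \<or> (\<exists>i<q. x i \<notin> g v)" if v: "v \<in> verts (Theta q) - {glue_pole}" for v
  proof -
    have "(\<exists>i<q. x i \<in> support ?\<phi> v) \<or> support ?\<phi> v = {t}"
      using v unfolding Theta_verts complete_bipartite_def
      by (auto simp: support_def labelling_def glue_pole_def less_2_cases_iff)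
    then show ?thesis using x(2) out by (auto simp: g_def)
  qed
qed

section \<open>Absence of partite representations\<close>

text \<open>Any two points of \<open>S\<close> lie in one of the three hyperedges, hence in different parts. So the \<open>k + 1\<close> points of
\<open>S\<close> would need \<open>k + 1\<close> parts.\<close>
lemma partite_no_three_facets:
  assumes part: "partite_hypergraph k X F" and k: "1 \<le> k"
    and S: "finite S" "card S = k + 1" "{x1, x2, x3} \<subseteq> S" "distinct [x1, x2, x3]"
    and F: "S - {x1} \<in> F" "S - {x2} \<in> F" "S - {x3} \<in> F"
  shows False
proof -
  have "\<exists>P. partition_on X P \<and> card P = k \<and> (\<forall>e\<in>F. \<forall>p\<in>P. card (e \<inter> p) = 1)"
    using part by (simp add: partite_hypergraph_def)
  then obtain P where P: "partition_on X P" "card P = k"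
    and one: "\<forall>e\<in>F. \<forall>p\<in>P. card (e \<inter> p) = 1"
    by (elim exE conjE)
  have FX: "e \<subseteq> X" if "e \<in> F" for e
    using part that unfolding partite_hypergraph_def uniform_hypergraph_def by blast
  have pair: "\<exists>e\<in>F. u \<in> e \<and> v \<in> e" if "u \<in> S" "v \<in> S" for u v
  proof -
    have "\<exists>x\<in>{x1, x2, x3}. x \<noteq> u \<and> x \<noteq> v" using S(4) by auto
    then obtain x where "S - {x} \<in> F" "x \<noteq> u" "x \<noteq> v" using F by auto
    then show ?thesis using that by (intro bexI[of _ "S - {x}"]) auto
  qed
  have "\<exists>p\<in>P. u \<in> p" if "u \<in> S" for u
  proof -
    obtain e where "e \<in> F" "u \<in> e" using pair[of u u] \<open>u \<in> S\<close> by auto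
    then have "u \<in> \<Union>P" using FX partition_onD1[OF P(1)] by auto
    then show ?thesis by simp
  qed
  then obtain p where p: "\<And>u. u \<in> S \<Longrightarrow> p u \<in> P \<and> u \<in> p u" by metis
  have "inj_on p S"
  proof (rule inj_onI)
    fix u v assume uv: "u \<in> S" "v \<in> S" "p u = p v"
    obtain e where e: "e \<in> F" "u \<in> e" "v \<in> e" using pair uv by blast
    have "card (e \<inter> p u) = 1" using one e(1) p uv by blast
    moreover have "u \<in> e \<inter> p u" "v \<in> e \<inter> p u" using e p uv by auto
    ultimately show "u = v" by (metis card_1_singletonE singletonD)
  qed
  moreover have "finite P" using P(2) k by (metis card.infinite not_one_le_zero)
  ultimately have "card S \<le> card P" using p by (intro card_inj_on_le[of p]) auto
  then show False using S(2) P(2) by simp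
qed

text \<open>The sets \<open>insert (y i) (a - {x i})\<close> are three neighbours of \<open>a\<close> at distance two that share neither the removed nor
the added element. Then \<open>a\<close> is their only common neighbour at distance at most two: a set \<open>b\<close> that almost contains all three
either misses some \<open>y i\<close>, which determines \<open>b\<close> up to one element and leaves no room for the other two added
elements, or contains all three, and then too few elements of \<open>a\<close> remain in \<open>b\<close>.\<close>
lemma no_distant_common_neighbour:
  assumes a: "finite a" "card a = k" "finite b" "card b = k" "a \<noteq> b"
    and x: "\<And>i. i \<in> I \<Longrightarrow> x i \<in> a" "inj_on x I"
    and y: "\<And>i. i \<in> I \<Longrightarrow> y i \<notin> a" "inj_on y I"
    and I: "card I = 3"
    and s: "\<And>i. i \<in> I \<Longrightarrow> card (insert (y i) (a - {x i}) - b) \<le> 1"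
  shows False
proof (cases "\<exists>i\<in>I. y i \<notin> b")
  case True
  have finI: "finite I" using I by (metis card.infinite zero_neq_numeral)
  have single: "z = z'" if "i \<in> I" "z \<in> insert (y i) (a - {x i}) - b" "z' \<in> insert (y i) (a - {x i}) - b" for i z z'
  proof -
    have "finite (insert (y i) (a - {x i}) - b)" using a by simp
    then show ?thesis using s[OF that(1)] that(2,3) by (metis One_nat_def card_le_Suc0_iff_eq)
  qed
  from True obtain i where i: "i \<in> I" "y i \<notin> b" by blast
  have ab: "a - {x i} \<subseteq> b"
    using single[OF i(1), of "y i"] i y(1)[OF i(1)] by blast
  have xb: "x i \<notin> b"
  proof
    assume "x i \<in> b"
    then have "a \<subseteq> b" using ab by blast
    then show False using a card_subset_eq by metis
  qed
  have yb: "y j \<in> b" if "j \<in> I" "j \<noteq> i" for j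
  proof (rule ccontr)
    assume "y j \<notin> b"
    moreover have "x i \<noteq> x j" using that i x(2) by (metis inj_onD)
    ultimately have "x i = y j"
      using single[OF that(1), of "x i" "y j"] xb x(1)[OF i(1)] by blast
    then show False using x(1)[OF i(1)] y(1)[OF that(1)] by simp
  qed
  have "card (y ` (I - {i})) = 2"
    using card_image[OF inj_on_subset[OF y(2)]] I i finI by (simp add: card_image inj_on_diff)
  moreover have "card (a - {x i}) = k - 1" using a x(1)[OF i(1)] by simp
  moreover have "card ((a - {x i}) \<union> y ` (I - {i})) = card (a - {x i}) + card (y ` (I - {i}))"
    using a finI y(1) by (intro card_Un_disjoint) auto
  moreover have "card ((a - {x i}) \<union> y ` (I - {i})) \<le> card b"
    using ab yb a by (intro card_mono) auto
  moreover have "1 \<le> k" using a(1,2) x(1)[OF i(1)] by (metis One_nat_def Suc_leI card_gt_0_iff empty_iff)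
  ultimately show False using a by linarith
next
  case False
  have finI: "finite I" using I by (metis card.infinite zero_neq_numeral)
  have 3: "card (y ` I) = 3" using card_image[OF y(2)] I by simp
  have "card ((a \<inter> b) \<union> y ` I) = card (a \<inter> b) + card (y ` I)"
    using a finI y(1) by (intro card_Un_disjoint) auto
  moreover have "card ((a \<inter> b) \<union> y ` I) \<le> card b"
    using False a by (intro card_mono) auto
  ultimately have ab: "card (a \<inter> b) + 3 \<le> k" using 3 a by simp
  have "I \<noteq> {}" using I by auto
  then obtain i where i: "i \<in> I" by blast
  have "k = card (a \<inter> b) + card (a - b)"
    using card_Int_Diff[OF a(1), of b] a(2) by simp
  moreover have "card (a - b) \<le> card (insert (x i) (insert (y i) (a - {x i}) - b))"
    using a by (intro card_mono) auto
  moreover have "\<dots> \<le> Suc (card (insert (y i) (a - {x i}) - b))" by (rule card_insert_le_m1[of "Suc _", simplified]) simp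
  ultimately show False using s[OF i] ab by linarith
qed

lemma edge_layer_nbrs:
  assumes "{A, B} \<in> edges (edge_layer n k)" "1 \<le> k"
  shows "A \<in> vertex_layer n k \<Longrightarrow> B \<in> vertex_layer n (k - 1) \<and> B \<subseteq> A"
    and "A \<in> vertex_layer n (k - 1) \<Longrightarrow> B \<in> vertex_layer n k \<and> A \<subseteq> B"
    and "A \<in> vertex_layer n k \<or> A \<in> vertex_layer n (k - 1)"
proof -
  obtain C D where CD: "{A, B} = {C, D}" "C \<subseteq> D" "card D = card C + 1"
    using assms(1) by (auto simp: edge_layer_def induced_subgraph_def hypercube_def)
  have "{A, B} \<subseteq> vertex_layer n k \<union> vertex_layer n (k - 1)"
    using assms(1) by (simp add: edge_layer_def induced_subgraph_def)
  then have "C \<in> vertex_layer n (k - 1)" "D \<in> vertex_layer n k"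
    using CD assms(2) by (auto simp: vertex_layer_def doubleton_eq_iff)
  moreover have "vertex_layer n (k - 1) \<inter> vertex_layer n k = {}"
    using assms(2) by (auto simp: vertex_layer_def)
  ultimately show "A \<in> vertex_layer n k \<Longrightarrow> B \<in> vertex_layer n (k - 1) \<and> B \<subseteq> A"
    and "A \<in> vertex_layer n (k - 1) \<Longrightarrow> B \<in> vertex_layer n k \<and> A \<subseteq> B"
    and "A \<in> vertex_layer n k \<or> A \<in> vertex_layer n (k - 1)"
    using CD(1,2) by (auto simp: doubleton_eq_iff)
qed

text \<open>If a main pole \<open>a\<close> were in the upper layer, then so would be the other main pole \<open>b\<close> and the poles
\<open>c i = insert (y i) (a - {x i})\<close> adjacent through subdivision vertices. Two equal \<open>y i\<close> give the three facets
\<open>a\<close>, \<open>c i\<close>, \<open>c j\<close> of a set of size \<open>k + 1\<close>, which a \<open>k\<close>-partite hypergraph cannot contain. If the \<open>y i\<close>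
are distinct, then \<open>b\<close> is a second common neighbour of all the \<open>c i\<close>, which is impossible too.\<close>
lemma main_pole_not_top:
  assumes q: "q \<ge> 3" and k: "1 \<le> k"
    and inj: "inj_on g (verts (Theta q))"
    and edges: "\<And>e. e \<in> edges (Theta q) \<Longrightarrow> g ` e \<in> edges (edge_layer n k)"
    and F: "g ` verts (Theta q) \<inter> vertex_layer n k \<subseteq> F" and part: "partite_hypergraph k X F"
  shows "g (Inl (Inr 0)) \<notin> vertex_layer n k"
proof
  define a where "a = g (Inl (Inr 0))"
  define b where "b = g (Inl (Inr 1))"
  define c where "c i = g (Inl (Inl i))" for i
  define s where "s i j = g (Inr {Inl i, Inr j})" for i j
  assume "g (Inl (Inr 0)) \<in> vertex_layer n k"
  then have a: "a \<in> vertex_layer n k" by (simp add: a_def)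
  have cs: "{c i, s i j} \<in> edges (edge_layer n k)" if "i < q" "j < 2" for i j
    using edges[OF Theta_edge(1)[OF that]] by (simp add: c_def s_def)
  have as: "{a, s i 0} \<in> edges (edge_layer n k)" if "i < q" for i
    using edges[OF Theta_edge(2)[OF that, of 0]] by (simp add: a_def s_def)
  have bs: "{b, s i 1} \<in> edges (edge_layer n k)" if "i < q" for i
    using edges[OF Theta_edge(2)[OF that, of 1]] by (simp add: b_def s_def)
  have s0: "s i 0 \<in> vertex_layer n (k - 1)" "s i 0 \<subseteq> a" if "i < q" for i
    using edge_layer_nbrs(1)[OF as k a] that by auto
  have c: "c i \<in> vertex_layer n k" "s i 0 \<subseteq> c i" if "i < q" for i
    using edge_layer_nbrs(2)[OF _ k s0(1), of i "c i"] cs[of i 0] that by (auto simp: insert_commute)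
  have s1: "s i 1 \<in> vertex_layer n (k - 1)" "s i 1 \<subseteq> c i" if "i < q" for i
    using edge_layer_nbrs(1)[OF cs k c(1)] that by auto
  have b: "b \<in> vertex_layer n k" "s i 1 \<subseteq> b" if "i < q" for i
    using edge_layer_nbrs(2)[OF _ k s1(1), of i b] bs[of i] that by (auto simp: insert_commute)
  have fin: "finite A \<and> card A = j" if "A \<in> vertex_layer n j" for A j
    using that by (auto simp: vertex_layer_def intro: finite_subset)
  have ab: "a \<noteq> b"
    using inj_onD[OF inj, of "Inl (Inr 0)" "Inl (Inr 1)"] Theta_vert(2)[of 0 q] q
    by (auto simp: a_def b_def)
  have inF: "a \<in> F" "\<And>i. i < q \<Longrightarrow> c i \<in> F"
    using F a c(1) Theta_vert[of 0 q 0] Theta_vert(1)[of _ q 0] q by (auto simp: a_def c_def)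
  have "\<exists>x y. x \<in> a \<and> y \<notin> a \<and> s i 0 = a - {x} \<and> c i = insert y (a - {x})" if i: "i < q" for i
  proof -
    have ne: "c i \<noteq> a"
      using inj_onD[OF inj, of "Inl (Inl i)" "Inl (Inr 0)"] Theta_vert(1,2)[of i q 0] i
      unfolding a_def c_def by fastforce
    have "card (a - s i 0) = 1" "card (c i - s i 0) = 1"
      using card_Diff_subset[of "s i 0"] s0[OF i] c[OF i] fin a k by auto
    then obtain x y where xy: "a - s i 0 = {x}" "c i - s i 0 = {y}" by (metis card_1_singletonE)
    then have s': "s i 0 = a - {x}" "c i = insert y (s i 0)" "x \<in> a" using s0[OF i] c[OF i] by auto
    moreover have "y \<notin> a"
    proof
      assume "y \<in> a"
      then have "c i \<subseteq> a" using s' by auto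
      then show False using ne fin[OF a] fin[OF c(1)[OF i]] card_subset_eq by metis
    qed
    ultimately show ?thesis by auto
  qed
  then obtain x y where xy: "\<And>i. i < q \<Longrightarrow> x i \<in> a" "\<And>i. i < q \<Longrightarrow> y i \<notin> a"
    "\<And>i. i < q \<Longrightarrow> s i 0 = a - {x i}" "\<And>i. i < q \<Longrightarrow> c i = insert (y i) (a - {x i})"
    by metis
  have x: "x i \<noteq> x j" if "i < q" "j < q" "i \<noteq> j" for i j
  proof
    assume "x i = x j"
    then have "s i 0 = s j 0" using xy(3) that by metis
    then have "{Inl i, Inr 0} = ({Inl j, Inr 0} :: (nat + nat) set)"
      using inj_onD[OF inj, of "Inr {Inl i, Inr 0}" "Inr {Inl j, Inr 0}"] Theta_vert(3)[of _ q 0] that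
      by (auto simp: s_def)
    then show False using that by (simp add: doubleton_eq_iff)
  qed
  have y: "y i \<noteq> y j" if ij: "i < q" "j < q" "i \<noteq> j" for i j
  proof
    assume eq: "y i = y j"
    let ?S = "insert (y i) a"
    have e: "?S - {y i} = a" "?S - {x i} = c i" "?S - {x j} = c j"
      using xy(1)[of i] xy(1)[of j] xy(2)[of i] xy(2)[of j] xy(4)[of i] xy(4)[of j] ij eq by auto
    have d: "x i \<in> ?S" "x j \<in> ?S" "y i \<noteq> x i" "y i \<noteq> x j"
      using xy(1)[OF ij(1)] xy(1)[OF ij(2)] xy(2)[OF ij(1)] by auto
    have "card ?S = k + 1" "finite ?S" using fin[OF a] xy(2)[OF ij(1)] by auto
    moreover have "distinct [y i, x i, x j]" using d x[OF ij] by simp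
    ultimately show False
      using partite_no_three_facets[OF part k, of ?S "y i" "x i" "x j"] d inF ij
      unfolding e by blast
  qed
  have I: "i < q" if "i \<in> {..<3}" for i :: nat using that q by simp
  have bl: "b \<in> vertex_layer n k" using b(1)[of 0] q by simp
  show False
  proof (rule no_distant_common_neighbour[of a k b "{..<3}" x y])
    show "inj_on x {..<3}" by (rule inj_onI) (use x I in blast)
    show "inj_on y {..<3}" by (rule inj_onI) (use y I in blast)
    fix i :: nat assume "i \<in> {..<3}"
    then have i: "i < q" using I by blast
    have "insert (y i) (a - {x i}) - b \<subseteq> c i - s i 1" using b(2)[OF i] xy(4)[OF i] by auto
    moreover have "card (c i - s i 1) = 1"
      using card_Diff_subset[of "s i 1"] s1[OF i] c[OF i] fin k by auto
    ultimately show "card (insert (y i) (a - {x i}) - b) \<le> 1"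
      using fin[OF c(1)[OF i]] by (metis card_mono finite_Diff)
  qed (use fin[OF a] fin[OF bl] ab xy I in auto)
qed

text \<open>Both copies must have their main poles in the lower layer. The subdivision vertex at which they are glued
is a neighbour of a main pole of the first copy and hence in the upper layer, but it is a main pole of the second.\<close>
lemma H_graph_no_partite_representation:
  assumes q: "q \<ge> 3"
  shows "\<not> has_partite_representation (H_graph q)"
proof
  assume "has_partite_representation (H_graph q)"
  then obtain k n H' X where k: "1 \<le> k" and sub: "subgraph H' (edge_layer n k)"
    and iso: "isomorphic (H_graph q) H'"
    and part: "partite_hypergraph k X (verts H' \<inter> vertex_layer n k)"
    unfolding has_partite_representation_def has_k_partite_representation_def by blast
  from iso obtain f where f: "bij_betw f (verts (H_graph q)) (verts H')"
    and adj: "\<And>u v. u \<in> verts (H_graph q) \<Longrightarrow> v \<in> verts (H_graph q) \<Longrightarrow>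
      {u, v} \<in> edges (H_graph q) \<longleftrightarrow> {f u, f v} \<in> edges H'"
    unfolding isomorphic_def by blast
  have fe: "f ` e \<in> edges (edge_layer n k)" if "e \<in> edges (H_graph q)" for e
  proof -
    have "e \<subseteq> verts (H_graph q)" "card e = 2"
      using simple_graph_H_graph that unfolding simple_graph_def by blast+
    then obtain u v where "e = {u, v}" "u \<in> verts (H_graph q)" "v \<in> verts (H_graph q)"
      by (metis card_2_iff insert_subset)
    then show ?thesis using adj that sub unfolding subgraph_def by auto
  qed
  have copy: "(f \<circ> h) (Inl (Inr 0)) \<notin> vertex_layer n k"
    if h: "inj h" "h ` verts (Theta q) \<subseteq> verts (H_graph q)" "(`) h ` edges (Theta q) \<subseteq> edges (H_graph q)" for h
  proof (rule main_pole_not_top[OF q k _ _ _ part])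
    show "inj_on (f \<circ> h) (verts (Theta q))"
      using h f by (meson bij_betw_def comp_inj_on inj_on_subset subset_UNIV)
    show "(f \<circ> h) ` e \<in> edges (edge_layer n k)" if "e \<in> edges (Theta q)" for e
      using fe[of "h ` e"] h(3) that by (auto simp: image_comp)
    show "(f \<circ> h) ` verts (Theta q) \<inter> vertex_layer n k \<subseteq> verts H' \<inter> vertex_layer n k"
      using h(2) f by (auto simp: bij_betw_def)
  qed
  have 1: "f (Inl (Inl (Inr 0))) \<notin> vertex_layer n k"
    using copy[of Inl] by (simp add: H_graph_def graph_union_def graph_image_def)
  have 2: "f (Inl glue_subdiv) \<notin> vertex_layer n k"
    using copy[OF inj_second_copy]
    by (simp add: H_graph_def graph_union_def graph_image_def second_copy_def glue_pole_def)
  have "{Inl (Inr 0), glue_subdiv} \<in> edges (Theta q)"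
    using Theta_edge(2)[of 0 q 0] q by (simp add: glue_subdiv_def)
  then have "Inl ` {Inl (Inr 0), glue_subdiv} \<in> edges (H_graph q)"
    unfolding H_graph_def graph_union_def graph_image_def graph.sel by blast
  from fe[OF this] have e: "{f (Inl (Inl (Inr 0))), f (Inl glue_subdiv)} \<in> edges (edge_layer n k)" by simp
  show False using edge_layer_nbrs(2,3)[OF e k] 1 2 by blast
qed

section \<open>Edges outside every \<open>K\<^bsub>2,r\<^esub>\<close>\<close>

text \<open>Adding one set at a time, each new set overlaps the union of the at most \<open>M\<close> earlier ones in at most \<open>M r\<close>
elements.\<close>
lemma card_UN_almost_disjoint:
  assumes "finite Y" "\<And>y. y \<in> Y \<Longrightarrow> finite (A y)" "\<And>y. y \<in> Y \<Longrightarrow> a \<le> real (card (A y))"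
    and "\<And>y z. y \<in> Y \<Longrightarrow> z \<in> Y \<Longrightarrow> y \<noteq> z \<Longrightarrow> card (A y \<inter> A z) \<le> r"
    and "card Y \<le> M"
  shows "real (card Y) * (a - real M * real r) \<le> real (card (\<Union>y\<in>Y. A y))"
  using assms
proof (induction Y rule: finite_induct)
  case empty
  then show ?case by simp
next
  case (insert y Y)
  let ?U = "\<Union>z\<in>Y. A z"
  have fin: "finite (A y)" "finite ?U" using insert by auto
  have "card (A y \<inter> ?U) = card (\<Union>z\<in>Y. A y \<inter> A z)" by (simp only: Int_UN_distrib)
  also have "\<dots> \<le> (\<Sum>z\<in>Y. card (A y \<inter> A z))" using insert.hyps by (intro card_UN_le) auto
  also have "\<dots> \<le> (\<Sum>z\<in>Y. r)" using insert.hyps insert.prems(3) by (intro sum_mono) auto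
  also have "\<dots> \<le> M * r" using insert.prems(4) insert.hyps by simp
  finally have "real (card (A y \<inter> ?U)) \<le> real M * real r"
    by (metis of_nat_le_iff of_nat_mult)
  moreover have "card (A y \<union> ?U) + card (A y \<inter> ?U) = card (A y) + card ?U"
    using card_Un_Int[OF fin] by simp
  moreover have "real (card Y) * (a - real M * real r) \<le> real (card ?U)"
    using insert.prems insert.hyps by (intro insert.IH) auto
  moreover have "a \<le> real (card (A y))" using insert.prems by simp
  ultimately show ?case using insert.hyps by (simp add: algebra_simps)
qed

text \<open>A graph on the vertex set \<open>X\<close> is given by its neighbourhoods \<open>N u\<close>. The edge from \<open>u\<close> to \<open>w\<close> is rich if it lies in a \<open>K\<^bsub>2,r\<^esub>\<close>
that has \<open>u\<close> on the side of size two.\<close>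
definition rich_edge :: "('a \<Rightarrow> 'a set) \<Rightarrow> 'a set \<Rightarrow> nat \<Rightarrow> 'a \<Rightarrow> 'a \<Rightarrow> bool" where
  "rich_edge N X r u w \<longleftrightarrow> (\<exists>t\<in>X. t \<noteq> u \<and> w \<in> N t \<and> r \<le> card (N u \<inter> N t))"

definition poor_edges :: "('a \<Rightarrow> 'a set) \<Rightarrow> 'a set \<Rightarrow> nat \<Rightarrow> ('a \<times> 'a) set" where
  "poor_edges N X r = (SIGMA u:X. {w \<in> N u. \<not> rich_edge N X r u w})"

text \<open>This plays the role of the Kovari-Sos-Turan bound for \<open>K\<^bsub>2,r\<^esub>\<close>, in a qualitative form. The poor neighbourhoods
of two different vertices share at most \<open>r\<close> vertices, since otherwise the two vertices would witness that the edges to their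
common poor neighbours are rich. Boundedly many almost disjoint sets of linear size already fill \<open>X\<close>, so all
but boundedly many vertices have only few poor edges.\<close>
lemma few_poor_edges:
  assumes "0 < c"
  shows "\<exists>K. \<forall>X (N :: 'a \<Rightarrow> 'a set). K \<le> card X \<and> (\<forall>u\<in>X. N u \<subseteq> X) \<longrightarrow>
    real (card (poor_edges N X r)) \<le> c * (real (card X))\<^sup>2"
proof -
  define d where "d = c / 2"
  \<comment> \<open>\<open>M\<close> almost disjoint sets of size \<open>d s\<close> would cover about \<open>2 s\<close> points; \<open>K\<close> makes the overlaps and the edges at \<open>M\<close> exceptional vertices negligible.\<close>
  define M where "M = nat \<lceil>2 / d\<rceil>"
  have d: "0 < d" using assms by (simp add: d_def)
  have M: "2 \<le> real M * d"
    using d by (simp add: M_def field_simps) (metis ceiling_divide_upper mult.commute of_int_nonneg real_nat_ceiling_ge pos_divide_le_eq)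
  define K where "K = M * M * r + nat \<lceil>real M / d\<rceil> + 1"
  have "nat \<lceil>real M / d\<rceil> \<le> K" by (simp add: K_def del: nat_ceiling_le_eq)
  then have K: "real M / d \<le> real K"
    using real_nat_ceiling_ge[of "real M / d"] by linarith
  have "real (card (poor_edges N X r)) \<le> c * (real (card X))\<^sup>2"
    if KX: "K \<le> card X" and NX: "\<forall>u\<in>X. N u \<subseteq> X" for X and N :: "'a \<Rightarrow> 'a set"
  proof -
    define s where "s = card X"
    define B where "B u = {w \<in> N u. \<not> rich_edge N X r u w}" for u
    have finX: "finite X" using KX by (intro card_ge_0_finite) (simp add: K_def)
    have BX: "B u \<subseteq> X" "finite (B u)" if "u \<in> X" for u
      using NX that finX by (auto simp: B_def intro: finite_subset)
    have Bs: "card (B u) \<le> s" if "u \<in> X" for u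
      using BX[OF that] finX by (simp add: s_def card_mono)
    have s: "real M * real M * real r < real s" "real M / d \<le> real s"
    proof -
      have "real (M * M * r) < real s" using KX unfolding s_def K_def by linarith
      then show "real M * real M * real r < real s" by simp
      show "real M / d \<le> real s" using K KX unfolding s_def by linarith
    qed
    have BB: "card (B u \<inter> B t) \<le> r" if "u \<in> X" "t \<in> X" "u \<noteq> t" for u t
    proof (rule ccontr)
      assume *: "\<not> card (B u \<inter> B t) \<le> r"
      then have "B u \<inter> B t \<noteq> {}" by auto
      then obtain w where w: "w \<in> B u" "w \<in> B t" by blast
      have "card (B u \<inter> B t) \<le> card (N u \<inter> N t)"
        using NX that finX by (intro card_mono) (auto simp: B_def intro: finite_subset)
      then have "rich_edge N X r u w"
        using w that * by (auto simp: rich_edge_def B_def)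
      then show False using w by (simp add: B_def)
    qed
    define L where "L = {u \<in> X. d * real s \<le> real (card (B u))}"
    have finL: "finite L" using finX by (simp add: L_def)
    have L: "card L \<le> M"
    proof (rule ccontr)
      assume "\<not> card L \<le> M"
      then obtain Y where Y: "Y \<subseteq> L" "card Y = M" "finite Y"
        by (metis obtain_subset_with_card_n nle_le)
      have "real (card Y) * (d * real s - real M * real r) \<le> real (card (\<Union>y\<in>Y. B y))"
        using Y by (intro card_UN_almost_disjoint) (auto simp: L_def intro: BX BB)
      also have "\<dots> \<le> real s"
        using Y BX finX unfolding s_def of_nat_le_iff by (intro card_mono) (auto simp: L_def)
      finally have "(real M * d) * real s \<le> real s + real M * real M * real r"
        using Y by (simp add: algebra_simps)
      moreover have "2 * real s \<le> (real M * d) * real s" using M by (intro mult_right_mono) auto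
      ultimately show False using s(1) by linarith
    qed
    have "real (card (SIGMA u:X. B u)) = (\<Sum>u\<in>X. real (card (B u)))"
      using finX BX by (simp add: card_SigmaI)
    also have "\<dots> = (\<Sum>u\<in>L. real (card (B u))) + (\<Sum>u\<in>X - L. real (card (B u)))"
      using finX by (intro sum.subset_diff[THEN trans[OF _ add.commute]]) (auto simp: L_def)
    also have "(\<Sum>u\<in>L. real (card (B u))) \<le> (\<Sum>u\<in>L. real s)"
      using Bs by (intro sum_mono) (auto simp: L_def)
    also have "(\<Sum>u\<in>L. real s) \<le> real M * real s"
      using L by (simp add: mult_right_mono)
    also have "real M * real s \<le> (d * real s) * real s"
      using s(2) d by (intro mult_right_mono) (auto simp: field_simps)
    also have "(\<Sum>u\<in>X - L. real (card (B u))) \<le> (\<Sum>u\<in>X - L. d * real s)"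
      by (intro sum_mono) (auto simp: L_def)
    also have "\<dots> \<le> real s * (d * real s)"
      using d finX by (auto simp: s_def intro!: mult_right_mono card_mono)
    finally show ?thesis by (simp add: poor_edges_def B_def s_def d_def power2_eq_square algebra_simps)
  qed
  then show ?thesis by blast
qed

text \<open>The common neighbour with index 0 has to be prescribed because \<open>glue_subdiv\<close> is the subdivision vertex
of the edge at \<open>Inl 0\<close>.\<close>
lemma enumerate_starting_at:
  assumes "finite A" "w \<in> A" "q \<le> card A"
  shows "\<exists>x. inj_on x {..<q} \<and> x ` {..<q} \<subseteq> A \<and> x (0::nat) = w"
proof -
  obtain h where h: "bij_betw h {0..<card A} A" using ex_bij_betw_nat_finite[OF assms(1)] by blast
  then have "w \<in> h ` {0..<card A}" using assms(2) by (simp add: bij_betw_def)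
  then obtain i where i: "i < card A" "h i = w" by auto
  let ?x = "h \<circ> transpose 0 i"
  have "0 < card A" using i by simp
  then have "bij_betw (transpose 0 i) {0..<card A} {0..<card A}"
    using i by (intro bij_betw_byWitness[of _ "transpose 0 i"]) (auto simp: transpose_def)
  from bij_betw_trans[OF this h] have "bij_betw ?x {0..<card A} A" .
  moreover have "{..<q} \<subseteq> {0..<card A}" using assms(3) by auto
  ultimately have "inj_on ?x {..<q}" "?x ` {..<q} \<subseteq> A"
    unfolding bij_betw_def by (auto intro: inj_on_subset)
  then show ?thesis using i by (intro exI[of _ ?x]) simp
qed

section \<open>Double counting in one layer\<close>

lemma Suc_times_choose_Suc: "Suc j * (n choose Suc j) = (n - j) * (n choose j)"
  by (simp only: binomial_absorption binomial_absorb_comp)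

lemma card_vertex_layer: "card (vertex_layer n k) = n choose k"
  using n_subsets[of "{1..n}" k] by (simp add: vertex_layer_def)

lemma finite_vertex_layer: "finite (vertex_layer n k)"
  by (simp add: vertex_layer_def)

lemma vertex_layerD: "v \<in> vertex_layer n k \<Longrightarrow> finite v \<and> card v = k \<and> v \<subseteq> {1..n}"
  by (auto simp: vertex_layer_def intro: finite_subset)

text \<open>A subgraph of the cube is described by its down-sets: \<open>x \<in> D v\<close> means that the edge between \<open>v - {x}\<close> and \<open>v\<close> is
present.\<close>
definition up_nbrs :: "nat \<Rightarrow> (nat set \<Rightarrow> nat set) \<Rightarrow> nat set \<Rightarrow> nat set" where
  "up_nbrs n D w = {y \<in> {1..n} - w. y \<in> D (insert y w)}"

text \<open>In the up-link of \<open>S\<close>, two elements \<open>u\<close> and \<open>w\<close> outside \<open>S\<close> are adjacent if \<open>S \<union> {u, w}\<close> is joined to both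
\<open>S \<union> {u}\<close> and \<open>S \<union> {w}\<close>. A \<open>K\<^bsub>2,q\<^esub>\<close> in it is a \<open>\<Theta>(q)\<close> with its poles in the lower layer.\<close>
definition up_link :: "nat \<Rightarrow> (nat set \<Rightarrow> nat set) \<Rightarrow> nat set \<Rightarrow> nat \<Rightarrow> nat set" where
  "up_link n D S u = {w \<in> {1..n} - S - {u}. {u, w} \<subseteq> D (S \<union> {u, w})}"

text \<open>The complementary link: \<open>x\<close> and \<open>y\<close> in \<open>S\<close> are adjacent if \<open>S - {x, y}\<close> is joined to both \<open>S - {x}\<close> and \<open>S - {y}\<close>. A
\<open>K\<^bsub>2,q\<^esub>\<close> in it is a \<open>\<Theta>(q)\<close> with its poles in the upper layer.\<close>
definition down_link :: "(nat set \<Rightarrow> nat set) \<Rightarrow> nat set \<Rightarrow> nat \<Rightarrow> nat set" where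
  "down_link D S y = {x \<in> S - {y}. x \<in> D (S - {y}) \<and> y \<in> D (S - {x})}"

definition popular_down :: "nat \<Rightarrow> (nat set \<Rightarrow> nat set) \<Rightarrow> real \<Rightarrow> nat set \<Rightarrow> nat set" where
  "popular_down n D a v = {x \<in> D v. a \<le> real (card (up_nbrs n D (v - {x})))}"

text \<open>Discarding the edges whose lower end has small up-degree loses at most a proportion \<open>\<delta>\<close> of the layer, and the vertices of the upper
layer that are left with small down-degree account for another proportion \<open>\<delta>\<close>. The remaining vertices carry a
proportion \<open>\<delta>\<close> of all edges, and each of them carries at most \<open>k\<close>.\<close>
lemma many_popular_vertices:
  fixes \<delta> :: real
  assumes D: "\<And>v. D v \<subseteq> v" and k: "1 \<le> k" "k \<le> n" and \<delta>: "0 < \<delta>"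
    and dense: "3 * \<delta> * real k * real (n choose k) \<le> (\<Sum>v\<in>vertex_layer n k. real (card (D v)))"
  defines "D' \<equiv> popular_down n D (\<delta> * real (n - k + 1))"
  shows "\<delta> * real (n choose k) \<le> real (card {v \<in> vertex_layer n k. \<delta> * real k \<le> real (card (D' v))})"
proof -
  let ?V = "vertex_layer n k" and ?m = "real (n - k + 1)"
  define W where "W = {v \<in> ?V. \<delta> * real k \<le> real (card (D' v))}"
  have fin: "finite ?V" "finite W" by (auto simp: finite_vertex_layer W_def)
  have fD: "finite (D v)" "D' v \<subseteq> D v" "card (D v) \<le> k" if "v \<in> ?V" for v
    using vertex_layerD[OF that] D[of v] by (auto simp: D'_def popular_down_def intro: finite_subset card_mono)
  define L where "L = {w \<in> vertex_layer n (k - 1). real (card (up_nbrs n D w)) < \<delta> * ?m}"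
  have finL: "finite L" by (simp add: L_def finite_vertex_layer)
  have fup: "finite (up_nbrs n D w)" for w by (simp add: up_nbrs_def)
  have "card (SIGMA v:?V. D v - D' v) \<le> card (SIGMA w:L. up_nbrs n D w)"
  proof (rule card_inj_on_le[where f = "\<lambda>(v, x). (v - {x}, x)"])
    show "inj_on (\<lambda>(v, x). (v - {x}, x)) (SIGMA v:?V. D v - D' v)"
      using D by (auto simp: inj_on_def)
    show "(\<lambda>(v, x). (v - {x}, x)) ` (SIGMA v:?V. D v - D' v) \<subseteq> (SIGMA w:L. up_nbrs n D w)"
    proof clarsimp
      fix v x assume v: "v \<in> ?V" "x \<in> D v" "x \<notin> D' v"
      then have x: "x \<in> v" "insert x v = v" "x \<in> {1..n}" using D vertex_layerD[OF v(1)] by blast+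
      show "v - {x} \<in> L \<and> x \<in> up_nbrs n D (v - {x})"
        using v x vertex_layerD[OF v(1)]
        by (auto simp: L_def up_nbrs_def D'_def popular_down_def vertex_layer_def)
    qed
    show "finite (SIGMA w:L. up_nbrs n D w)" using finL fup by auto
  qed
  then have "real (card (SIGMA v:?V. D v - D' v)) \<le> real (card (SIGMA w:L. up_nbrs n D w))"
    by (rule of_nat_mono)
  also have "\<dots> = (\<Sum>w\<in>L. real (card (up_nbrs n D w)))"
    using finL fup by (simp add: card_SigmaI)
  also have "\<dots> \<le> (\<Sum>w\<in>L. \<delta> * ?m)" by (intro sum_mono) (auto simp: L_def)
  also have "\<dots> \<le> real (n choose (k - 1)) * (\<delta> * ?m)"
    unfolding card_vertex_layer[symmetric]
    using \<delta> by (auto simp: L_def finite_vertex_layer intro!: mult_right_mono card_mono)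
  also have "\<dots> = \<delta> * (real k * real (n choose k))"
  proof -
    have "k * (n choose k) = (n - k + 1) * (n choose (k - 1))"
      using Suc_times_choose_Suc[of "k - 1" n] k by (simp add: Suc_diff_le)
    then have "real k * real (n choose k) = ?m * real (n choose (k - 1))"
      by (metis of_nat_mult)
    then show ?thesis by simp
  qed
  finally have lost: "(\<Sum>v\<in>?V. real (card (D v - D' v))) \<le> \<delta> * (real k * real (n choose k))"
    using fin fD by (simp add: card_SigmaI)
  have "(\<Sum>v\<in>?V. real (card (D v))) = (\<Sum>v\<in>?V. real (card (D' v))) + (\<Sum>v\<in>?V. real (card (D v - D' v)))"
    unfolding sum.distrib[symmetric]
  proof (intro sum.cong refl)
    fix v assume "v \<in> ?V"
    then have "card (D v) = card (D' v) + card (D v - D' v)"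
      using fD[of v] by (metis card_Diff_subset card_mono finite_subset le_add_diff_inverse)
    then show "real (card (D v)) = real (card (D' v)) + real (card (D v - D' v))" by simp
  qed
  with lost dense have "2 * \<delta> * (real k * real (n choose k)) \<le> (\<Sum>v\<in>?V. real (card (D' v)))" by linarith
  also have "\<dots> = (\<Sum>v\<in>W. real (card (D' v))) + (\<Sum>v\<in>?V - W. real (card (D' v)))"
    using fin by (intro sum.subset_diff[THEN trans[OF _ add.commute]]) (auto simp: W_def)
  also have "(\<Sum>v\<in>W. real (card (D' v))) \<le> (\<Sum>v\<in>W. real k)"
  proof (rule sum_mono)
    fix v assume "v \<in> W"
    then have "card (D' v) \<le> k" using fD[of v] by (metis (no_types, lifting) W_def card_mono le_trans mem_Collect_eq)
    then show "real (card (D' v)) \<le> real k" by simp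
  qed
  also have "(\<Sum>v\<in>?V - W. real (card (D' v))) \<le> (\<Sum>v\<in>?V - W. \<delta> * real k)"
    by (intro sum_mono) (auto simp: W_def)
  also have "\<dots> \<le> real (n choose k) * (\<delta> * real k)"
    unfolding card_vertex_layer[symmetric] using \<delta> fin by (auto intro!: mult_right_mono card_mono)
  finally have "real k * (\<delta> * real (n choose k)) \<le> real k * real (card W)"
    by (simp add: algebra_simps)
  then show ?thesis using k unfolding W_def[symmetric] by (simp add: mult_le_cancel_left_pos)
qed

text \<open>\<open>up_rich\<close> says that \<open>v\<close> is a subdivision vertex of a \<open>\<Theta>\<close> with poles below it, coming from the pair \<open>{u, w}\<close> in the up-link of
\<open>v - {u, w}\<close>. The set \<open>down_rich\<close> collects the \<open>y\<close> for which \<open>v\<close> is a main pole of a \<open>\<Theta>\<close> in the down-link of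
\<open>insert y v\<close>, where \<open>v\<close> corresponds to the element \<open>y\<close>.\<close>
definition up_rich :: "nat \<Rightarrow> (nat set \<Rightarrow> nat set) \<Rightarrow> nat \<Rightarrow> nat set \<Rightarrow> nat \<Rightarrow> nat \<Rightarrow> bool" where
  "up_rich n D r v u w \<longleftrightarrow> u \<in> D v \<and> w \<in> D v \<and> u \<noteq> w \<and>
    rich_edge (up_link n D (v - {u, w})) ({1..n} - (v - {u, w})) r u w"

definition down_rich :: "nat \<Rightarrow> (nat set \<Rightarrow> nat set) \<Rightarrow> nat \<Rightarrow> nat set \<Rightarrow> nat set" where
  "down_rich n D r v = {y \<in> {1..n} - v. \<exists>x. rich_edge (down_link D (insert y v)) (insert y v) r y x}"

text \<open>Every pair \<open>u \<noteq> w\<close> in \<open>D v\<close> is an edge of the up-link of \<open>v - {u, w}\<close>. If \<open>v\<close> has no rich pair, then all of its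
quadratically many pairs are poor. The pair together with \<open>v - {u, w}\<close> determines \<open>v\<close>, so the poor edges of the up-links bound the number of such
vertices.\<close>
lemma few_vertices_without_up_rich:
  fixes \<delta> c :: real
  assumes D: "\<And>v. D v \<subseteq> v" and k: "2 \<le> k" "k \<le> n" and \<delta>: "0 < \<delta>" "2 \<le> \<delta> * real k"
    and K: "K \<le> n - k" and c: "0 < c"
    and poor: "\<And>X (N :: nat \<Rightarrow> nat set). K \<le> card X \<Longrightarrow> \<forall>u\<in>X. N u \<subseteq> X \<Longrightarrow>
      real (card (poor_edges N X r)) \<le> c * (real (card X))\<^sup>2"
  shows "\<delta>\<^sup>2 * real (card {v \<in> vertex_layer n k. \<delta> * real k \<le> real (card (D v)) \<and> (\<nexists>u w. up_rich n D r v u w)})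
    \<le> 4 * c * real (n choose k)"
proof -
  define B where "B = {v \<in> vertex_layer n k. \<delta> * real k \<le> real (card (D v)) \<and> (\<nexists>u w. up_rich n D r v u w)}"
  define X where "X S = {1..n} - S" for S :: "nat set"
  let ?P = "\<lambda>v. SIGMA u:D v. D v - {u}" and ?V' = "vertex_layer n (k - 2)"
  let ?E = "\<lambda>S. poor_edges (up_link n D S) (X S) r"
  have finB: "finite B" by (simp add: B_def finite_vertex_layer)
  have fD: "finite (D v)" if "v \<in> B" for v
    using vertex_layerD[of v n k] that D[of v] by (auto simp: B_def intro: finite_subset)
  have NX: "up_link n D S u \<subseteq> X S" for S u by (auto simp: up_link_def X_def)
  have finE: "finite (?E S)" for S
    using NX by (auto simp: poor_edges_def X_def up_link_def)
  have "card (Sigma B ?P) \<le> card (Sigma ?V' ?E)"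
  proof (rule card_inj_on_le[where f = "\<lambda>(v, u, w). (v - {u, w}, u, w)"])
    show "inj_on (\<lambda>(v, u, w). (v - {u, w}, u, w)) (Sigma B ?P)"
    proof (rule inj_onI)
      fix p p' assume p: "p \<in> Sigma B ?P" "p' \<in> Sigma B ?P"
        "(\<lambda>(v, u, w). (v - {u, w}, u, w)) p = (\<lambda>(v, u, w). (v - {u, w}, u, w)) p'"
      obtain v u w v' u' w' where q: "p = (v, u, w)" "p' = (v', u', w')" by (metis prod_cases3)
      have e: "v - {u, w} = v' - {u, w}" "u' = u" "w' = w" using p(3) unfolding q by auto
      have "{u, w} \<subseteq> v" "{u, w} \<subseteq> v'" using p(1,2) D unfolding q e(2,3) by blast+
      then have "v = v - {u, w} \<union> {u, w}" "v' = v' - {u, w} \<union> {u, w}" by auto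
      then show "p = p'" using e unfolding q by metis
    qed
    show "(\<lambda>(v, u, w). (v - {u, w}, u, w)) ` Sigma B ?P \<subseteq> Sigma ?V' ?E"
    proof (rule image_subsetI)
      fix p assume p: "p \<in> Sigma B ?P"
      obtain v u w where q: "p = (v, u, w)" by (metis prod_cases3)
      have *: "v \<in> B" "u \<in> D v" "w \<in> D v" "w \<noteq> u" using p unfolding q by auto
      have v: "finite v" "card v = k" "v \<subseteq> {1..n}" using vertex_layerD[of v n k] *(1) by (auto simp: B_def)
      have uw: "u \<in> v" "w \<in> v" using * D by blast+
      then have eq: "v - {u, w} \<union> {u, w} = v" by blast
      have "card (v - {u, w}) = k - 2" using v uw *(4) by (simp add: card_Diff_subset)
      then have "v - {u, w} \<in> ?V'" using v by (auto simp: vertex_layer_def)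
      moreover have "w \<in> up_link n D (v - {u, w}) u"
      proof -
        have "w \<in> {1..n} - (v - {u, w}) - {u}" using uw v(3) *(4) by blast
        then show ?thesis using *(2,3) unfolding up_link_def mem_Collect_eq eq by simp
      qed
      moreover have "\<not> rich_edge (up_link n D (v - {u, w})) (X (v - {u, w})) r u w"
      proof -
        have "\<not> up_rich n D r v u w" using *(1) unfolding B_def by simp
        then show ?thesis using *(2-4) unfolding up_rich_def X_def by simp
      qed
      moreover have "u \<in> X (v - {u, w})" using uw v(3) unfolding X_def by blast
      ultimately show "(\<lambda>(v, u, w). (v - {u, w}, u, w)) p \<in> Sigma ?V' ?E"
        unfolding q by (simp add: poor_edges_def)
    qed
    show "finite (Sigma ?V' ?E)" using finE by (simp add: finite_vertex_layer)
  qed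
  then have "real (card (Sigma B ?P)) \<le> real (card (Sigma ?V' ?E))" by (rule of_nat_mono)
  also have "\<dots> = (\<Sum>S\<in>?V'. real (card (?E S)))"
    using finE by (simp add: card_SigmaI finite_vertex_layer)
  also have "\<dots> \<le> (\<Sum>S\<in>?V'. c * (real (n - k + 2))\<^sup>2)"
  proof (rule sum_mono)
    fix S assume "S \<in> ?V'"
    then have "card (X S) = n - k + 2"
      using vertex_layerD[of S n "k - 2"] k by (simp add: X_def card_Diff_subset)
    then show "real (card (?E S)) \<le> c * (real (n - k + 2))\<^sup>2"
      using poor[of "X S" "up_link n D S"] NX K by simp
  qed
  also have "\<dots> = c * ((real (n - k + 2))\<^sup>2 * real (n choose (k - 2)))"
    by (simp add: card_vertex_layer)
  also have "\<dots> \<le> c * (2 * ((real k)\<^sup>2 * real (n choose k)))"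
  proof -
    have 1: "k * (n choose k) = (n - k + 1) * (n choose (k - 1))"
      using Suc_times_choose_Suc[of "k - 1" n] k by (simp add: Suc_diff_le)
    have 2: "(k - 1) * (n choose (k - 1)) = (n - k + 2) * (n choose (k - 2))"
      using Suc_times_choose_Suc[of "k - 2" n] k by (simp add: Suc_diff_le numeral_2_eq_2 Suc_diff_Suc)
    have "(n - k + 2)^2 * (n choose (k - 2)) = (n - k + 2) * ((k - 1) * (n choose (k - 1)))"
      unfolding 2 by (simp only: power2_eq_square mult.assoc)
    also have "\<dots> \<le> (2 * (n - k + 1)) * (k * (n choose (k - 1)))"
      by (intro mult_mono) auto
    also have "\<dots> = 2 * k * (k * (n choose k))" unfolding 1 by (simp only: mult_ac)
    finally have "(n - k + 2)^2 * (n choose (k - 2)) \<le> 2 * (k^2 * (n choose k))"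
      by (simp add: power2_eq_square)
    then have "real ((n - k + 2)^2 * (n choose (k - 2))) \<le> real (2 * (k^2 * (n choose k)))"
      by (rule of_nat_mono)
    then show ?thesis using c by (simp add: mult_left_mono)
  qed
  finally have up: "real (card (Sigma B ?P)) \<le> c * (2 * ((real k)\<^sup>2 * real (n choose k)))" .
  have "real (card B) * (\<delta>\<^sup>2 * (real k)\<^sup>2 / 2) = (\<Sum>v\<in>B. \<delta>\<^sup>2 * (real k)\<^sup>2 / 2)" by simp
  also have "\<dots> \<le> (\<Sum>v\<in>B. real (card (?P v)))"
  proof (rule sum_mono)
    fix v assume v: "v \<in> B"
    then have d: "\<delta> * real k \<le> real (card (D v))" by (simp add: B_def)
    have "card (?P v) = card (D v) * (card (D v) - 1)"
      using fD[OF v] by (simp add: card_SigmaI)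
    then have "real (card (?P v)) = real (card (D v)) * (real (card (D v)) - 1)"
      using d \<delta> by (cases "card (D v)") (auto simp: algebra_simps)
    moreover have "(\<delta> * real k) * (\<delta> * real k / 2) \<le> real (card (D v)) * (real (card (D v)) - 1)"
      using d \<delta> by (intro mult_mono) auto
    ultimately show "\<delta>\<^sup>2 * (real k)\<^sup>2 / 2 \<le> real (card (?P v))" by (simp add: power2_eq_square algebra_simps)
  qed
  also have "\<dots> = real (card (Sigma B ?P))"
    using finB fD by (simp add: card_SigmaI)
  finally have "(real k)\<^sup>2 * (\<delta>\<^sup>2 * real (card B)) \<le> (real k)\<^sup>2 * (4 * c * real (n choose k))"
    using up by (simp add: algebra_simps)
  then show ?thesis using k unfolding B_def[symmetric] by (simp add: mult_le_cancel_left_pos)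
qed

text \<open>A path from \<open>v\<close> down to \<open>v - {x}\<close> and up to \<open>insert y (v - {x})\<close> is an edge between \<open>y\<close> and \<open>x\<close> in the down-link of \<open>insert y v\<close>.
A vertex with many popular down-neighbours starts at least about \<open>\<delta>\<^sup>2 k (n - k)\<close> such paths. If only \<open>Q\<close> elements \<open>y\<close> are
rich, then all but \<open>k Q\<close> of these paths are poor edges. Again \<open>insert y v\<close> and \<open>y\<close> determine \<open>v\<close>.\<close>
lemma few_vertices_without_down_rich:
  fixes \<delta> c :: real
  assumes D: "\<And>v. D v \<subseteq> v" and k: "1 \<le> k" "k \<le> n" and \<delta>: "0 < \<delta>"
    and m: "2 * (\<delta> + real Q) \<le> \<delta>\<^sup>2 * real (n - k + 1)" "1 \<le> \<delta> * real (n - k + 1)"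
    and K: "K \<le> k" and c: "0 < c"
    and poor: "\<And>X (N :: nat \<Rightarrow> nat set). K \<le> card X \<Longrightarrow> \<forall>u\<in>X. N u \<subseteq> X \<Longrightarrow>
      real (card (poor_edges N X r)) \<le> c * (real (card X))\<^sup>2"
  shows "\<delta>\<^sup>2 * real (card {v \<in> vertex_layer n k.
      \<delta> * real k \<le> real (card (popular_down n D (\<delta> * real (n - k + 1)) v)) \<and> card (down_rich n D r v) \<le> Q})
    \<le> 4 * c * real (n choose k)"
proof -
  let ?m = "real (n - k + 1)"
  define D' where "D' = popular_down n D (\<delta> * ?m)"
  define B where "B = {v \<in> vertex_layer n k. \<delta> * real k \<le> real (card (D' v)) \<and> card (down_rich n D r v) \<le> Q}"
  let ?T = "\<lambda>v. SIGMA x:D' v. up_nbrs n D (v - {x}) - {x}" and ?V' = "vertex_layer n (k + 1)"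
  let ?P = "\<lambda>v. ?T v - v \<times> down_rich n D r v"
  let ?E = "\<lambda>S. poor_edges (down_link D S) S r"
  have finB: "finite B" by (simp add: B_def finite_vertex_layer)
  have v: "finite v" "card v = k" "v \<subseteq> {1..n}" if "v \<in> B" for v
    using vertex_layerD[of v n k] that by (auto simp: B_def)
  have D'D: "D' v \<subseteq> D v" for v by (auto simp: D'_def popular_down_def)
  have D'v: "D' v \<subseteq> v" for v using D'D D by blast
  have fD: "finite (D' v)" if "v \<in> B" for v
    using v[OF that] D'v by (metis finite_subset)
  have fup: "finite (up_nbrs n D w)" for w by (simp add: up_nbrs_def)
  have finT: "finite (?T v)" if "v \<in> B" for v using fD[OF that] fup by auto
  have finE: "finite (?E S)" if "S \<in> ?V'" for S
    using vertex_layerD[OF that] by (auto simp: poor_edges_def down_link_def)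
  have "card (Sigma B ?P) \<le> card (Sigma ?V' ?E)"
  proof (rule card_inj_on_le[where f = "\<lambda>(v, x, y). (insert y v, y, x)"])
    have yv: "y \<notin> v" if "v \<in> B" "(x, y) \<in> ?P v" for v x y
      using that by (auto simp: up_nbrs_def)
    show "inj_on (\<lambda>(v, x, y). (insert y v, y, x)) (Sigma B ?P)"
    proof (rule inj_onI)
      fix p p' assume p: "p \<in> Sigma B ?P" "p' \<in> Sigma B ?P"
        "(\<lambda>(v, x, y). (insert y v, y, x)) p = (\<lambda>(v, x, y). (insert y v, y, x)) p'"
      obtain v x y v' x' y' where q: "p = (v, x, y)" "p' = (v', x', y')" by (metis prod_cases3)
      have "y \<notin> v" "y' \<notin> v'" using p(1,2) yv unfolding q by blast+
      then show "p = p'" using p(3) unfolding q by auto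
    qed
    show "(\<lambda>(v, x, y). (insert y v, y, x)) ` Sigma B ?P \<subseteq> Sigma ?V' ?E"
    proof (rule image_subsetI)
      fix p assume p: "p \<in> Sigma B ?P"
      obtain v x y where q: "p = (v, x, y)" by (metis prod_cases3)
      have vB: "v \<in> B" and xy: "x \<in> D' v" "y \<in> up_nbrs n D (v - {x})" "y \<noteq> x"
        and nr: "x \<in> v \<Longrightarrow> y \<notin> down_rich n D r v" using p unfolding q by auto
      have x: "x \<in> v" "x \<in> D v" using xy D'D D'v by blast+
      have y: "y \<notin> v" "y \<in> {1..n}" "y \<in> D (insert y (v - {x}))" using xy x by (auto simp: up_nbrs_def)
      have eq: "insert y v - {y} = v" "insert y v - {x} = insert y (v - {x})" using y xy by auto
      have "x \<in> down_link D (insert y v) y"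
        using x y xy unfolding down_link_def eq by (simp add: eq)
      moreover have "\<not> rich_edge (down_link D (insert y v)) (insert y v) r y x"
        using nr x y by (auto simp: down_rich_def)
      moreover have "insert y v \<in> ?V'" using v[OF vB] y by (simp add: vertex_layer_def)
      ultimately show "(\<lambda>(v, x, y). (insert y v, y, x)) p \<in> Sigma ?V' ?E"
        unfolding q by (simp add: poor_edges_def)
    qed
    show "finite (Sigma ?V' ?E)" using finE by (simp add: finite_vertex_layer)
  qed
  then have "real (card (Sigma B ?P)) \<le> real (card (Sigma ?V' ?E))" by (rule of_nat_mono)
  also have "\<dots> = (\<Sum>S\<in>?V'. real (card (?E S)))"
    using finE by (simp add: card_SigmaI finite_vertex_layer)
  also have "\<dots> \<le> (\<Sum>S\<in>?V'. c * (real (k + 1))\<^sup>2)"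
  proof (rule sum_mono)
    fix S assume "S \<in> ?V'"
    then have "card S = k + 1" using vertex_layerD[of S n "k + 1"] by simp
    then show "real (card (?E S)) \<le> c * (real (k + 1))\<^sup>2"
      using poor[of S "down_link D S"] K by (auto simp: down_link_def)
  qed
  also have "\<dots> = c * ((real (k + 1))\<^sup>2 * real (n choose (k + 1)))"
    by (simp add: card_vertex_layer)
  also have "\<dots> \<le> c * (2 * (real k * (?m * real (n choose k))))"
  proof -
    have 1: "(k + 1) * (n choose (k + 1)) = (n - k) * (n choose k)"
      using Suc_times_choose_Suc[of k n] by simp
    have "(k + 1)^2 * (n choose (k + 1)) = (k + 1) * ((k + 1) * (n choose (k + 1)))"
      by (simp only: power2_eq_square mult.assoc)
    also have "\<dots> = (k + 1) * ((n - k) * (n choose k))" unfolding 1 ..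
    also have "\<dots> \<le> (2 * k) * ((n - k + 1) * (n choose k))"
      using k by (intro mult_mono) auto
    finally have "(k + 1)^2 * (n choose (k + 1)) \<le> 2 * (k * ((n - k + 1) * (n choose k)))" by simp
    then have "real ((k + 1)^2 * (n choose (k + 1))) \<le> real (2 * (k * ((n - k + 1) * (n choose k))))"
      by (rule of_nat_mono)
    then have "(real (k + 1))\<^sup>2 * real (n choose (k + 1)) \<le> 2 * (real k * (?m * real (n choose k)))"
      by (simp only: of_nat_mult of_nat_power of_nat_numeral)
    then show ?thesis using c by (intro mult_left_mono) auto
  qed
  finally have up: "real (card (Sigma B ?P)) \<le> c * (2 * (real k * (?m * real (n choose k))))" .
  have "real (card B) * (\<delta>\<^sup>2 * real k * ?m / 2) = (\<Sum>v\<in>B. \<delta>\<^sup>2 * real k * ?m / 2)" by simp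
  also have "\<dots> \<le> (\<Sum>v\<in>B. real (card (?P v)))"
  proof (rule sum_mono)
    fix v assume vB: "v \<in> B"
    then have d: "\<delta> * real k \<le> real (card (D' v))" by (simp add: B_def)
    have "real (card (?T v)) = (\<Sum>x\<in>D' v. real (card (up_nbrs n D (v - {x}) - {x})))"
      using fD[OF vB] fup by (simp add: card_SigmaI)
    also have "\<dots> \<ge> (\<Sum>x\<in>D' v. \<delta> * ?m - 1)"
    proof (rule sum_mono)
      fix x assume "x \<in> D' v"
      then have "\<delta> * ?m \<le> real (card (up_nbrs n D (v - {x})))" by (simp add: D'_def popular_down_def)
      moreover have "card (up_nbrs n D (v - {x})) \<le> Suc (card (up_nbrs n D (v - {x}) - {x}))"
        by (cases "x \<in> up_nbrs n D (v - {x})") (simp_all add: fup)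
      ultimately show "\<delta> * ?m - 1 \<le> real (card (up_nbrs n D (v - {x}) - {x}))" by linarith
    qed
    finally have "real (card (D' v)) * (\<delta> * ?m - 1) \<le> real (card (?T v))" by simp
    moreover have "(\<delta> * real k) * (\<delta> * ?m - 1) \<le> real (card (D' v)) * (\<delta> * ?m - 1)"
      using d m by (intro mult_right_mono) auto
    ultimately have T: "(\<delta> * real k) * (\<delta> * ?m - 1) \<le> real (card (?T v))" by linarith
    have fr: "finite (down_rich n D r v)" by (simp add: down_rich_def)
    have "card (?T v) - card (v \<times> down_rich n D r v) \<le> card (?P v)"
      using v[OF vB] fr by (intro diff_card_le_card_Diff) auto
    moreover have "card (v \<times> down_rich n D r v) \<le> k * Q"
      using vB v[OF vB] by (simp add: card_cartesian_product B_def)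
    ultimately have "card (?T v) \<le> card (?P v) + k * Q" by linarith
    then have "real (card (?T v)) \<le> real (card (?P v) + k * Q)" by (rule of_nat_mono)
    then have "real (card (?T v)) \<le> real (card (?P v)) + real k * real Q"
      by (simp only: of_nat_add of_nat_mult)
    moreover have "real k * (2 * (\<delta> + real Q)) \<le> real k * (\<delta>\<^sup>2 * ?m)"
      using m(1) by (rule mult_left_mono) simp
    ultimately show "\<delta>\<^sup>2 * real k * ?m / 2 \<le> real (card (?P v))"
      using T by (simp add: power2_eq_square algebra_simps)
  qed
  also have "\<dots> = real (card (Sigma B ?P))"
    using finB finT by (simp add: card_SigmaI)
  finally have "(real k * ?m) * (\<delta>\<^sup>2 * real (card B)) \<le> (real k * ?m) * (4 * c * real (n choose k))"
    using up by (simp add: algebra_simps)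
  moreover have "0 < real k * ?m" using k by simp
  ultimately show ?thesis unfolding B_def[symmetric] D'_def[symmetric]
    by (simp only: mult_le_cancel_left_pos)
qed

text \<open>With \<open>c = \<delta>\<^sup>3 / 16\<close> each of the two exceptional sets has at most a proportion \<open>\<delta> / 4\<close> of the layer, so together they cannot
cover the proportion \<open>\<delta>\<close> of vertices with many popular down-neighbours.\<close>
lemma dense_layer_has_rich_vertex:
  fixes \<delta> :: real
  assumes \<delta>: "0 < \<delta>"
  shows "\<exists>K. \<forall>n k D. K \<le> k \<and> k + K \<le> n \<and> (\<forall>v. D v \<subseteq> v) \<and>
    3 * \<delta> * real k * real (n choose k) \<le> (\<Sum>v\<in>vertex_layer n k. real (card (D v))) \<longrightarrow>
    (\<exists>v\<in>vertex_layer n k. (\<exists>u w. up_rich n D r v u w) \<and> Q < card (down_rich n D r v))"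
proof -
  define c where "c = \<delta> ^ 3 / 16"
  have c: "0 < c" using \<delta> by (simp add: c_def)
  obtain K0 where K0: "\<And>X (N :: nat \<Rightarrow> nat set). K0 \<le> card X \<Longrightarrow> \<forall>u\<in>X. N u \<subseteq> X \<Longrightarrow>
      real (card (poor_edges N X r)) \<le> c * (real (card X))\<^sup>2"
    using few_poor_edges[OF c, where 'a = nat] by blast
  \<comment> \<open>beyond \<open>K1\<close> both \<open>\<delta> k\<close> and \<open>\<delta> (n - k + 1)\<close> are at least 2, and \<open>\<delta>\<^sup>2 (n - k + 1)\<close> absorbs the \<open>Q\<close> exceptional elements\<close>
  define K1 where "K1 = nat \<lceil>2 / \<delta> + 2 * (\<delta> + real Q) / \<delta>\<^sup>2\<rceil>"
  define K where "K = K0 + K1 + 2"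
  have K1: "2 / \<delta> + 2 * (\<delta> + real Q) / \<delta>\<^sup>2 \<le> real K1" unfolding K1_def by (rule real_nat_ceiling_ge)
  have "\<exists>v\<in>vertex_layer n k. (\<exists>u w. up_rich n D r v u w) \<and> Q < card (down_rich n D r v)"
    if k: "K \<le> k" "k + K \<le> n" and D: "\<forall>v. D v \<subseteq> v"
      and dense: "3 * \<delta> * real k * real (n choose k) \<le> (\<Sum>v\<in>vertex_layer n k. real (card (D v)))" for n k D
  proof (rule ccontr)
    assume none: "\<not> ?thesis"
    let ?V = "vertex_layer n k" and ?D' = "popular_down n D (\<delta> * real (n - k + 1))"
    let ?W = "{v \<in> ?V. \<delta> * real k \<le> real (card (?D' v))}"
    let ?A = "{v \<in> ?V. \<delta> * real k \<le> real (card (D v)) \<and> (\<nexists>u w. up_rich n D r v u w)}"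
    let ?B = "{v \<in> ?V. \<delta> * real k \<le> real (card (?D' v)) \<and> card (down_rich n D r v) \<le> Q}"
    have pos: "0 \<le> 2 * (\<delta> + real Q) / \<delta>\<^sup>2" "0 \<le> 2 / \<delta>" using \<delta> by auto
    have big: "2 / \<delta> \<le> real k" "2 / \<delta> \<le> real (n - k + 1)" "2 * (\<delta> + real Q) / \<delta>\<^sup>2 \<le> real (n - k + 1)"
      using K1 k pos unfolding K_def by linarith+
    have W: "\<delta> * real (n choose k) \<le> real (card ?W)"
      using D k \<delta> dense unfolding K_def by (intro many_popular_vertices) auto
    have A: "\<delta>\<^sup>2 * real (card ?A) \<le> 4 * c * real (n choose k)"
    proof (rule few_vertices_without_up_rich[where K = K0])
      show "2 \<le> \<delta> * real k" using big(1) \<delta> by (simp add: pos_divide_le_eq mult.commute)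
      show "2 \<le> k" "k \<le> n" "K0 \<le> n - k" using k unfolding K_def by linarith+
      show "D v \<subseteq> v" for v using D by blast
    qed (rule K0 \<delta> c; assumption)+
    have B: "\<delta>\<^sup>2 * real (card ?B) \<le> 4 * c * real (n choose k)"
    proof (rule few_vertices_without_down_rich[where K = K0])
      show "2 * (\<delta> + real Q) \<le> \<delta>\<^sup>2 * real (n - k + 1)"
        using big(3) \<delta> by (simp add: pos_divide_le_eq mult.commute)
      have "2 \<le> \<delta> * real (n - k + 1)"
        using big(2) \<delta> by (simp add: pos_divide_le_eq mult.commute)
      then show "1 \<le> \<delta> * real (n - k + 1)" by linarith
      show "1 \<le> k" "k \<le> n" "K0 \<le> k" using k unfolding K_def by linarith+
      show "D v \<subseteq> v" for v using D by blast
    qed (rule K0 \<delta> c; assumption)+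
    have "card ?W \<le> card (?A \<union> ?B)"
    proof (rule card_mono)
      show "finite (?A \<union> ?B)" by (simp add: finite_vertex_layer)
      show "?W \<subseteq> ?A \<union> ?B"
      proof
        fix v assume v: "v \<in> ?W"
        have "finite (D v)" "?D' v \<subseteq> D v"
          using vertex_layerD[of v n k] v D by (auto simp: popular_down_def intro: finite_subset)
        then have "card (?D' v) \<le> card (D v)" by (rule card_mono)
        then have "\<delta> * real k \<le> real (card (D v))" using v by auto
        then show "v \<in> ?A \<union> ?B" using v none by (auto simp: not_less)
      qed
    qed
    also have "\<dots> \<le> card ?A + card ?B" by (rule card_Un_le)
    finally have "real (card ?W) \<le> real (card ?A) + real (card ?B)" by linarith
    then have "\<delta>\<^sup>2 * real (card ?W) \<le> \<delta>\<^sup>2 * real (card ?A) + \<delta>\<^sup>2 * real (card ?B)"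
      unfolding distrib_left[symmetric] by (rule mult_left_mono) simp
    also have "\<dots> \<le> 8 * c * real (n choose k)" using A B by linarith
    also have "\<dots> = \<delta>\<^sup>2 * (\<delta> * real (n choose k)) / 2"
      by (simp add: c_def power2_eq_square power3_eq_cube)
    also have "\<dots> < \<delta>\<^sup>2 * (\<delta> * real (n choose k))" using \<delta> k by simp
    also have "\<dots> \<le> \<delta>\<^sup>2 * real (card ?W)" using W by (intro mult_left_mono) auto
    finally show False by simp
  qed
  then show ?thesis by blast
qed

section \<open>Turan density\<close>

definition down_set :: "nat set graph \<Rightarrow> nat set \<Rightarrow> nat set" where
  "down_set G v = {x \<in> v. {v - {x}, v} \<in> edges G}"

text \<open>The vertex \<open>v\<close> is a subdivision vertex of a copy of \<open>\<Theta>(q)\<close> with poles below and a main pole of a copy with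
poles above. The surplus in the two bounds keeps the copies apart: \<open>y\<close> is chosen outside the at most \<open>q + 1\<close>
elements \<open>t\<close>, \<open>x i\<close> of the first copy, and the elements \<open>x' i\<close> of the second avoid \<open>u\<close> and \<open>w\<close>, so they
belong to \<open>S = v - {u, w}\<close>, which is contained in every vertex of the first copy. A vertex of the second copy other than \<open>v\<close> contains \<open>y\<close> or
misses some \<open>x' i\<close>, and no vertex of the first copy does either.\<close>
lemma rich_vertex_gives_H_graph:
  assumes G: "simple_graph G" and q: "0 < q"
    and v: "v \<in> vertex_layer n k"
    and up: "up_rich n (down_set G) (q + 2) v u w"
    and down: "q + 1 < card (down_rich n (down_set G) (q + 2) v)"
  shows "\<exists>H'. subgraph H' G \<and> isomorphic (H_graph q) H'"
proof -
  let ?D = "down_set G"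
  have finv: "finite v" using vertex_layerD[OF v] by blast
  define S where "S = v - {u, w}"
  have uw: "u \<in> v" "w \<in> v" "u \<noteq> w" and ulnk: "w \<in> up_link n ?D S u"
  proof -
    show *: "u \<in> v" "w \<in> v" "u \<noteq> w" using up by (auto simp: up_rich_def down_set_def)
    then have "S \<union> {u, w} = v" by (auto simp: S_def)
    moreover have "w \<in> {1..n}" using * vertex_layerD[OF v] by blast
    ultimately show "w \<in> up_link n ?D S u"
      using up * by (auto simp: up_link_def up_rich_def S_def)
  qed
  obtain t where t: "t \<in> {1..n} - S" "t \<noteq> u" "w \<in> up_link n ?D S t"
      "q + 2 \<le> card (up_link n ?D S u \<inter> up_link n ?D S t)"
    using up unfolding up_rich_def rich_edge_def S_def by blast
  have "finite (up_link n ?D S u \<inter> up_link n ?D S t)" by (simp add: up_link_def)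
  then obtain x where x: "inj_on x {..<q}" "x ` {..<q} \<subseteq> up_link n ?D S u \<inter> up_link n ?D S t" "x 0 = w"
    using enumerate_starting_at[of "up_link n ?D S u \<inter> up_link n ?D S t" w q] ulnk t(3,4) by auto
  have xo: "x i \<notin> S" "x i \<noteq> u" "x i \<noteq> t" if "i < q" for i
    using x(2) that by (auto simp: up_link_def)
  have xD: "{p, x i} \<subseteq> ?D (S \<union> {p, x i})" if "i < q" "p \<in> {u, t}" for i p
    using x(2) that by (auto simp: up_link_def)
  have "\<not> down_rich n ?D (q + 2) v \<subseteq> insert t (x ` {..<q})"
  proof
    assume "down_rich n ?D (q + 2) v \<subseteq> insert t (x ` {..<q})"
    then have "card (down_rich n ?D (q + 2) v) \<le> card (insert t (x ` {..<q}))" by (intro card_mono) auto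
    also have "\<dots> \<le> Suc (card (x ` {..<q}))" by (rule card_insert_le_m1) auto
    also have "\<dots> \<le> Suc q" using card_image_le[of "{..<q}" x] by simp
    finally show False using down by simp
  qed
  then obtain y where y: "y \<in> down_rich n ?D (q + 2) v" "y \<noteq> t" "y \<notin> x ` {..<q}" by blast
  define S' where "S' = insert y v"
  have yv: "y \<notin> v" using y(1) by (simp add: down_rich_def)
  obtain z where z: "z \<in> S'" "z \<noteq> y" "q + 2 \<le> card (down_link ?D S' y \<inter> down_link ?D S' z)"
    using y(1) unfolding down_rich_def rich_edge_def S'_def by blast
  define C where "C = (down_link ?D S' y \<inter> down_link ?D S' z) - {u, w}"
  have "card (down_link ?D S' y \<inter> down_link ?D S' z) - card {u, w} \<le> card C"
    unfolding C_def by (rule diff_card_le_card_Diff) simp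
  then have cC: "q \<le> card C" using z(3) uw(3) by simp
  have finC: "finite C" using finv by (auto simp: C_def down_link_def S'_def)
  obtain w' where "w' \<in> C" using cC q by fastforce
  then obtain x' where x': "inj_on x' {..<q}" "x' ` {..<q} \<subseteq> C"
    using enumerate_starting_at[OF finC _ cC] by blast
  have x'o: "x' i \<in> S" "x' i \<noteq> y" "x' i \<noteq> z" "x' i \<in> S'" if "i < q" for i
    using x'(2) that by (auto simp: C_def down_link_def S_def S'_def)
  have x'D: "x' i \<in> ?D (S' - {p}) \<and> p \<in> ?D (S' - {x' i})" if "i < q" "p \<in> {y, z}" for i p
    using x'(2) that by (auto simp: C_def down_link_def)
  define g1 where "g1 = (\<lambda>a. S \<union> support (labelling x u t) a)"
  define g2 where "g2 = (\<lambda>a. S' - support (labelling x' y z) a)"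
  have D_edge: "{A - {p}, A} \<in> edges G" if "p \<in> ?D A" for p A
    using that by (simp add: down_set_def)
  have adj1: "{S \<union> {p}, S \<union> {p, x i}} \<in> edges G \<and> {S \<union> {x i}, S \<union> {p, x i}} \<in> edges G"
    if i: "i < q" and p: "p \<in> {u, t}" for i p
  proof -
    have "p \<notin> S" "x i \<noteq> p" "x i \<notin> S" using p t(1) xo[OF i] by (auto simp: S_def)
    then have "S \<union> {p, x i} - {x i} = S \<union> {p}" "S \<union> {p, x i} - {p} = S \<union> {x i}" by auto
    then show ?thesis
      using D_edge[of "x i" "S \<union> {p, x i}"] D_edge[of p "S \<union> {p, x i}"] xD[OF i p] by simp
  qed
  have adj2: "{S' - {p}, S' - {p, x' i}} \<in> edges G \<and> {S' - {x' i}, S' - {p, x' i}} \<in> edges G"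
    if i: "i < q" and p: "p \<in> {y, z}" for i p
  proof -
    have "S' - {p} - {x' i} = S' - {p, x' i}" "S' - {x' i} - {p} = S' - {p, x' i}" by auto
    then show ?thesis
      using D_edge[of "x' i" "S' - {p}"] D_edge[of p "S' - {x' i}"] x'D[OF i p]
      by (simp add: insert_commute)
  qed
  have d1: "u \<noteq> t" "{u, t} \<inter> x ` {..<q} = {}" "S \<inter> ({u, t} \<union> x ` {..<q}) = {}"
    using t(1,2) xo by (auto simp: S_def)
  have d2: "y \<noteq> z" "{y, z} \<inter> x' ` {..<q} = {}" "{y, z} \<union> x' ` {..<q} \<subseteq> S'"
    using z(1,2) x'o by (auto simp: S'_def)
  have up_copy: "inj_on g1 (verts (Theta q))" "\<And>e. e \<in> edges (Theta q) \<Longrightarrow> g1 ` e \<in> edges G"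
    "\<And>a. a \<in> verts (Theta q) \<Longrightarrow> g1 a \<subseteq> S \<union> ({u, t} \<union> x ` {..<q})"
    unfolding g1_def by (rule Theta_in_up_link[OF x(1) d1 adj1]; assumption)+
  have down_copy: "inj_on g2 (verts (Theta q))" "\<And>e. e \<in> edges (Theta q) \<Longrightarrow> g2 ` e \<in> edges G"
    "\<And>b. b \<in> verts (Theta q) - {glue_pole} \<Longrightarrow> y \<in> g2 b \<or> (\<exists>i<q. x' i \<notin> g2 b)"
    unfolding g2_def by (rule Theta_in_down_link[OF x'(1) d2 adj2]; assumption)+
  show ?thesis
  proof (rule H_graph_embedding[OF G q])
    show "inj_on g1 (verts (Theta q))" by (rule up_copy(1))
    show "inj_on g2 (verts (Theta q))" by (rule down_copy(1))
    show "g1 ` e \<in> edges G" if "e \<in> edges (Theta q)" for e by (rule up_copy(2)[OF that])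
    show "g2 ` e \<in> edges G" if "e \<in> edges (Theta q)" for e by (rule down_copy(2)[OF that])
    have "g1 glue_subdiv = v"
      using uw by (auto simp: g1_def glue_subdiv_def support_def labelling_def x(3) S_def)
    moreover have "g2 glue_pole = v"
      using yv by (auto simp: g2_def glue_pole_def support_def labelling_def S'_def)
    ultimately show "g1 glue_subdiv = g2 glue_pole" by simp
    show "g1 ` verts (Theta q) \<inter> g2 ` (verts (Theta q) - {glue_pole}) = {}"
    proof (rule ccontr)
      assume "g1 ` verts (Theta q) \<inter> g2 ` (verts (Theta q) - {glue_pole}) \<noteq> {}"
      then obtain a b where ab: "a \<in> verts (Theta q)" "b \<in> verts (Theta q) - {glue_pole}" "g1 a = g2 b"
        by blast
      have "y \<notin> S \<union> ({u, t} \<union> x ` {..<q})" using y yv uw by (auto simp: S_def)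
      then have "y \<notin> g1 a" using up_copy(3)[OF ab(1)] by blast
      moreover have "x' i \<in> g1 a" if "i < q" for i using x'o(1)[OF that] by (simp add: g1_def)
      ultimately show False using down_copy(3)[OF ab(2)] ab(3) by auto
    qed
  qed
qed

lemma card_edges_eq_sum_down_set:
  assumes "subgraph G (hypercube n)"
  shows "card (edges G) = (\<Sum>k\<le>n. \<Sum>v\<in>vertex_layer n k. card (down_set G v))"
proof -
  have sub: "edges G \<subseteq> edges (hypercube n)" using assms by (simp add: subgraph_def)
  have fin: "finite (down_set G v)" if "v \<in> Pow {1..n}" for v
    using that by (auto simp: down_set_def intro: finite_subset)
  have "bij_betw (\<lambda>(v, x). {v - {x}, v}) (Sigma (Pow {1..n}) (down_set G)) (edges G)"
    unfolding bij_betw_def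
  proof (intro conjI equalityI subsetI)
    show "inj_on (\<lambda>(v, x). {v - {x}, v}) (Sigma (Pow {1..n}) (down_set G))"
    proof (rule inj_onI)
      fix p p' assume p: "p \<in> Sigma (Pow {1..n}) (down_set G)" "p' \<in> Sigma (Pow {1..n}) (down_set G)"
        "(\<lambda>(v, x). {v - {x}, v}) p = (\<lambda>(v, x). {v - {x}, v}) p'"
      obtain v x v' x' where q: "p = (v, x)" "p' = (v', x')" by (metis surj_pair)
      have x: "x \<in> v" "x' \<in> v'" using p(1,2) by (auto simp: q down_set_def)
      have "{v - {x}, v} = {v' - {x'}, v'}" using p(3) by (simp add: q)
      then have "v - {x} = v' - {x'} \<and> v = v'" using x by (metis Diff_iff Diff_subset doubleton_eq_iff insertI1 subset_antisym)
      then show "p = p'" using x unfolding q by blast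
    qed
  next
    fix e assume "e \<in> (\<lambda>(v, x). {v - {x}, v}) ` Sigma (Pow {1..n}) (down_set G)"
    then show "e \<in> edges G" by (auto simp: down_set_def)
  next
    fix e assume e: "e \<in> edges G"
    then obtain A B where AB: "e = {A, B}" "A \<subseteq> B" "B \<subseteq> {1..n}" "card B = card A + 1"
      using sub by (auto simp: hypercube_def)
    have "finite B" using AB(3) by (rule finite_subset) simp
    then have "card (B - A) = 1" using AB by (simp add: card_Diff_subset finite_subset)
    then obtain x where x: "B - A = {x}" by (metis card_1_singletonE)
    then have A: "A = B - {x}" "x \<in> B" using AB(2) by auto
    then have "e = (\<lambda>(v, x). {v - {x}, v}) (B, x)" "x \<in> down_set G B"
      using AB(1) e by (auto simp: down_set_def)
    then show "e \<in> (\<lambda>(v, x). {v - {x}, v}) ` Sigma (Pow {1..n}) (down_set G)"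
      using AB(3) by blast
  qed
  then have "card (edges G) = card (Sigma (Pow {1..n}) (down_set G))" by (rule bij_betw_same_card[symmetric])
  also have "\<dots> = (\<Sum>v\<in>Pow {1..n}. card (down_set G v))" by (rule card_SigmaI) (use fin in simp_all)
  also have "\<dots> = (\<Sum>k\<le>n. \<Sum>v\<in>{v \<in> Pow {1..n}. card v = k}. card (down_set G v))"
  proof (rule sum.group[symmetric])
    show "card ` Pow {1..n} \<subseteq> {..n}"
    proof (rule image_subsetI)
      fix v assume "v \<in> Pow {1..n}"
      then have "card v \<le> card {1..n}" by (intro card_mono) simp_all
      then show "card v \<in> {..n}" by simp
    qed
  qed simp_all
  also have "\<dots> = (\<Sum>k\<le>n. \<Sum>v\<in>vertex_layer n k. card (down_set G v))"
    by (simp only: vertex_layer_def Pow_iff)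
  finally show ?thesis .
qed

lemma down_set_hypercube: "v \<subseteq> {1..n} \<Longrightarrow> down_set (hypercube n) v = v"
proof -
  assume v: "v \<subseteq> {1..n}"
  have "{v - {x}, v} \<in> edges (hypercube n)" if "x \<in> v" for x
  proof -
    have "card v = card (v - {x}) + 1"
      using that v by (metis Suc_eq_plus1 card.remove finite_atLeastAtMost finite_subset)
    then show ?thesis using v unfolding hypercube_def graph.sel by blast
  qed
  then show ?thesis by (auto simp: down_set_def)
qed

lemma card_edges_hypercube: "card (edges (hypercube n)) = n * 2 ^ (n - 1)"
proof -
  have "subgraph (hypercube n) (hypercube n)" by (simp add: subgraph_def simple_graph_hypercube)
  then have "card (edges (hypercube n)) = (\<Sum>k\<le>n. \<Sum>v\<in>vertex_layer n k. card (down_set (hypercube n) v))"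
    by (rule card_edges_eq_sum_down_set)
  also have "\<dots> = (\<Sum>k\<le>n. \<Sum>v\<in>vertex_layer n k. k)"
    by (intro sum.cong refl) (use vertex_layerD down_set_hypercube in metis)
  also have "\<dots> = (\<Sum>k\<le>n. k * (n choose k))" by (simp add: card_vertex_layer mult.commute)
  finally show ?thesis by (simp add: choose_linear_sum)
qed

text \<open>There are boundedly many layers near the bottom and the top, and each has polynomially many edges.\<close>
lemma outer_layers_negligible:
  fixes \<delta> :: real
  assumes "0 < \<delta>"
  shows "\<forall>\<^sub>F n in sequentially. (\<Sum>k | k \<le> n \<and> (k < K \<or> n < k + K). real k * real (n choose k))
    \<le> \<delta> * (real n * 2 ^ (n - 1))"
proof -
  have "(\<lambda>n. real n ^ K / 2 ^ n) \<longlonglongrightarrow> 0"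
    by real_asymp
  then have "\<forall>\<^sub>F n in sequentially. real n ^ K / 2 ^ n < \<delta> / (4 * (real K + 1))"
    using assms by (intro order_tendstoD(2)) auto
  moreover have "\<forall>\<^sub>F n in sequentially. 1 \<le> n" by (rule eventually_ge_at_top)
  ultimately show ?thesis
  proof eventually_elim
    case (elim n)
    let ?I = "{k. k \<le> n \<and> (k < K \<or> n < k + K)}"
    have "real k * real (n choose k) \<le> real n * real n ^ K" if k: "k \<in> ?I" for k
    proof -
      have "real (n choose j) \<le> real n ^ K" if "j < K" "j \<le> n" for j
      proof -
        have "n choose j \<le> n ^ j" using that(2) by (rule binomial_le_pow)
        also have "\<dots> \<le> n ^ K" using that elim(2) by (intro power_increasing) auto
        finally show ?thesis by (metis of_nat_le_iff of_nat_power)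
      qed
      from this[of k] this[of "n - k"] have "real (n choose k) \<le> real n ^ K"
        using k binomial_symmetric[of k n] by (auto simp: less_diff_conv2)
      then show ?thesis using k by (intro mult_mono) auto
    qed
    then have "(\<Sum>k\<in>?I. real k * real (n choose k)) \<le> real (card ?I) * (real n * real n ^ K)"
      by (rule sum_bounded_above)
    also have "real (card ?I) \<le> 2 * (real K + 1)"
    proof -
      have "?I \<subseteq> {..<K} \<union> {n - K..n}" by auto
      then have "card ?I \<le> card ({..<K} \<union> {n - K..n})" by (intro card_mono) auto
      also have "\<dots> \<le> card {..<K} + card {n - K..n}" by (rule card_Un_le)
      finally have "card ?I \<le> 2 * (K + 1)" by simp
      then have "real (card ?I) \<le> real (2 * (K + 1))" by (rule of_nat_mono)
      then show ?thesis by simp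
    qed
    finally have "(\<Sum>k\<in>?I. real k * real (n choose k)) \<le> (2 * (real K + 1) * real n) * real n ^ K"
      by (simp add: mult_right_mono algebra_simps)
    also have "\<dots> \<le> (2 * (real K + 1) * real n) * (\<delta> / (4 * (real K + 1)) * 2 ^ n)"
      using elim(1) by (intro mult_left_mono) (auto simp: divide_less_eq)
    also have "\<dots> = \<delta> * (real n * 2 ^ (n - 1))"
      using elim(2) by (cases n) (auto simp: field_simps)
    finally show ?case .
  qed
qed

text \<open>In an \<open>H(q)\<close>-free subgraph every layer at distance at least \<open>K\<close> from both ends has density below \<open>c / 2\<close>, and the
remaining layers contain at most a proportion \<open>c / 2\<close> of the edges of the cube.\<close>
lemma H_graph_zero_turan_density:
  assumes q: "0 < q"
  shows "zero_turan_density (H_graph q)"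
  unfolding zero_turan_density_def
proof (rule landau_o.smallI)
  fix c :: real assume c: "0 < c"
  \<comment> \<open>the density threshold for a single layer is \<open>3 \<delta> = c / 2\<close>\<close>
  define \<delta> where "\<delta> = c / 6"
  have \<delta>: "0 < \<delta>" using c by (simp add: \<delta>_def)
  obtain K where "\<forall>n k D. K \<le> k \<and> k + K \<le> n \<and> (\<forall>v. D v \<subseteq> v) \<and>
      3 * \<delta> * real k * real (n choose k) \<le> (\<Sum>v\<in>vertex_layer n k. real (card (D v))) \<longrightarrow>
      (\<exists>v\<in>vertex_layer n k. (\<exists>u w. up_rich n D (q + 2) v u w) \<and> q + 1 < card (down_rich n D (q + 2) v))"
    using dense_layer_has_rich_vertex[OF \<delta>, of "q + 2" "q + 1"] by blast
  then have K: "\<exists>v\<in>vertex_layer n k. (\<exists>u w. up_rich n D (q + 2) v u w) \<and> q + 1 < card (down_rich n D (q + 2) v)"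
    if "K \<le> k" "k + K \<le> n" "\<forall>v. D v \<subseteq> v"
      "3 * \<delta> * real k * real (n choose k) \<le> (\<Sum>v\<in>vertex_layer n k. real (card (D v)))" for n k D
    using that by blast
  have "\<forall>\<^sub>F n in sequentially. (\<Sum>k | k \<le> n \<and> (k < K \<or> n < k + K). real k * real (n choose k))
    \<le> (c / 2) * (real n * 2 ^ (n - 1))"
    by (rule outer_layers_negligible) (use c in simp)
  then show "\<forall>\<^sub>F n in sequentially. norm (real (ex_number (hypercube n) (H_graph q)))
      \<le> c * norm (real (card (edges (hypercube n))))"
  proof eventually_elim
    case (elim n)
    let ?N = "real n * 2 ^ (n - 1)"
    have bound: "real (card (edges G)) \<le> c * ?N"
      if G: "subgraph G (hypercube n)" and free: "\<not> (\<exists>H'. subgraph H' G \<and> isomorphic (H_graph q) H')" for G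
    proof -
      let ?I = "{k. k \<le> n \<and> (k < K \<or> n < k + K)}"
      let ?d = "\<lambda>k. \<Sum>v\<in>vertex_layer n k. real (card (down_set G v))"
      have sG: "simple_graph G" using G by (simp add: subgraph_def)
      have Dv: "\<forall>v. down_set G v \<subseteq> v" by (auto simp: down_set_def)
      have inner: "?d k \<le> 3 * \<delta> * (real k * real (n choose k))" if "k \<in> {..n} - ?I" for k
      proof (rule ccontr)
        assume "\<not> ?thesis"
        then have "3 * \<delta> * real k * real (n choose k) \<le> ?d k" by (simp add: mult.assoc)
        moreover have "K \<le> k" "k + K \<le> n" using that by auto
        ultimately show False
          using K[OF _ _ Dv] rich_vertex_gives_H_graph[OF sG q] free by blast
      qed
      have outer: "?d k \<le> real k * real (n choose k)" for k
      proof -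
        have "?d k \<le> (\<Sum>v\<in>vertex_layer n k. real k)"
        proof (rule sum_mono)
          fix v assume "v \<in> vertex_layer n k"
          then show "real (card (down_set G v)) \<le> real k"
            using vertex_layerD Dv by (metis card_mono of_nat_le_iff)
        qed
        then show ?thesis by (simp add: card_vertex_layer mult.commute)
      qed
      have "(\<Sum>k\<in>?I. ?d k) \<le> (\<Sum>k\<in>?I. real k * real (n choose k))"
        by (rule sum_mono) (rule outer)
      then have 1: "(\<Sum>k\<in>?I. ?d k) \<le> (c / 2) * ?N" using elim by (rule order_trans)
      have "(\<Sum>k\<in>{..n} - ?I. ?d k) \<le> (\<Sum>k\<in>{..n} - ?I. 3 * \<delta> * (real k * real (n choose k)))"
        by (rule sum_mono) (rule inner)
      also have "\<dots> \<le> (\<Sum>k\<le>n. 3 * \<delta> * (real k * real (n choose k)))"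
        by (rule sum_mono2) (use \<delta> in auto)
      also have "\<dots> = 3 * \<delta> * real (\<Sum>k\<le>n. k * (n choose k))"
        by (simp add: sum_distrib_left)
      also have "\<dots> = (c / 2) * ?N" unfolding choose_linear_sum by (simp add: \<delta>_def)
      finally have 2: "(\<Sum>k\<in>{..n} - ?I. ?d k) \<le> (c / 2) * ?N" .
      have "real (card (edges G)) = (\<Sum>k\<le>n. ?d k)"
        using card_edges_eq_sum_down_set[OF G] by simp
      also have "\<dots> = (\<Sum>k\<in>{..n} - ?I. ?d k) + (\<Sum>k\<in>?I. ?d k)"
        by (rule sum.subset_diff) auto
      finally show ?thesis using 1 2 by linarith
    qed
    have ne: "verts (H_graph q) \<noteq> {}"
      using Theta_vert[of 0 q 0] q by (auto simp: H_graph_def graph_union_def graph_image_def)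
    note wf = ex_number_wf[OF simple_graph_hypercube[of n] ne]
    have "ex_number (hypercube n) (H_graph q) \<in> {card (edges G') | G'. subgraph G' (hypercube n) \<and>
        \<not> (\<exists>H'. subgraph H' G' \<and> isomorphic (H_graph q) H')}"
      unfolding ex_number_def by (rule Max_in[OF wf])
    then have "real (ex_number (hypercube n) (H_graph q)) \<le> c * ?N" using bound by auto
    then show ?case by (simp add: card_edges_hypercube)
  qed
qed

text \<open>If no cube contained \<open>H\<close>, then the whole cube would be \<open>H\<close>-free and the extremal number would equal \<open>\<parallel>Q\<^sub>n\<parallel>\<close>.\<close>
lemma zero_turan_density_imp_cubical:
  assumes "verts H \<noteq> {}" "zero_turan_density H"
  shows "cubical H"
proof (rule ccontr)
  assume *: "\<not> cubical H"
  have full: "real (card (edges (hypercube n))) \<le> real (ex_number (hypercube n) H)" for n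
  proof -
    have "subgraph (hypercube n) (hypercube n)" by (simp add: subgraph_def simple_graph_hypercube)
    moreover have "\<not> (\<exists>H'. subgraph H' (hypercube n) \<and> isomorphic H H')"
      using * unfolding cubical_def by blast
    ultimately have "card (edges (hypercube n)) \<in> {card (edges G') | G'. subgraph G' (hypercube n) \<and>
        \<not> (\<exists>H'. subgraph H' G' \<and> isomorphic H H')}" by blast
    then show ?thesis
      unfolding ex_number_def of_nat_le_iff
      by (rule Max_ge[OF ex_number_wf(1)[OF simple_graph_hypercube assms(1)]])
  qed
  have "\<forall>\<^sub>F n in sequentially. real (ex_number (hypercube n) H) \<le> 1 / 2 * real (card (edges (hypercube n)))"
    using landau_o.smallD[OF assms(2)[unfolded zero_turan_density_def], of "1/2"] by simp
  then have "\<forall>\<^sub>F n in sequentially. card (edges (hypercube n)) = 0"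
  proof eventually_elim
    case (elim n)
    then have "real (card (edges (hypercube n))) \<le> 1 / 2 * real (card (edges (hypercube n)))"
      using full[of n] by linarith
    then show ?case by simp
  qed
  then have "\<forall>\<^sub>F n in sequentially. n = (0 :: nat)"
    by (rule eventually_mono) (simp add: card_edges_hypercube)
  then obtain N where N: "\<And>n :: nat. N \<le> n \<Longrightarrow> n = 0" by (auto simp: eventually_sequentially)
  show False using N[of "Suc N"] by simp
qed

theorem theorem2:
  fixes q :: nat
  assumes "q \<ge> 3"
  shows "cubical (H_graph q) \<and> \<not> has_partite_representation (H_graph q) \<and>
    zero_turan_density (H_graph q)"
proof (intro conjI)
  show z: "zero_turan_density (H_graph q)"
    using assms by (intro H_graph_zero_turan_density) simp
  have "verts (H_graph q) \<noteq> {}"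
    using Theta_vert[of 0 q 0] assms by (auto simp: H_graph_def graph_union_def graph_image_def)
  then show "cubical (H_graph q)" using z by (rule zero_turan_density_imp_cubical)
  show "\<not> has_partite_representation (H_graph q)"
    using assms by (rule H_graph_no_partite_representation)
qed

end
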